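(* Let $\Phi=(A;\{E_i\}_{i=0}^d;A^*;\{E^*_i\}_{i=0}^d)$ be a Leonard system in $\mathcal{A}$ with parameter array $(\{\theta_i\}_{i=0}^d;\{\theta^*_i\}_{i=0}^d;\{\varphi_i\}_{i=1}^d;\{\phi_i\}_{i=1}^d)$, and let $\xi_0\in E_0V$, $\xi_d\in E_dV$, $\xi^*_0\in E^*_0V$, $\xi^*_d\in E^*_dV$ be nonzero vectors. Then (i) and (ii) hold. (i) Let $\{X_i\}_{i=0}^d$ denote one of the sequences $\{E_i\}_{i=0}^d$, $\{E_{d-i}\}_{i=0}^d$, $\{\tau_i(A)\}_{i=0}^d$, $\{\tau_{d-i}(A)\}_{i=0}^d$, $\{\eta_i(A)\}_{i=0}^d$, $\{\eta_{d-i}(A)\}_{i=0}^d$. Then for $0\le i\le d$, \begin{align*} \frac{\tau_d(\theta_d)}{\varphi}\frac{\langle\xi^*_0,\xi^*_0\rangle}{\langle\xi_0,\xi^*_0\rangle}\sum_{r=0}^dX_rE^*_0E_d\tau^*_{d-r}(A^* )\cdot\eta^*_i(A^* )\xi_0 &= X_i\xi^*_0,\\ \frac{\langle\xi^*_d,\xi^*_d\rangle}{\langle\xi_0,\xi^*_d\rangle}\sum_{r=0}^d\frac{X_rE^*_d\tau_r(A)}{\phi_d\phi_{d-1}\cdots\phi_{d-r+1}}\cdot\eta^*_i(A^* )\xi_0 &= X_i\xi^*_d,\\ \frac{\tau_d(\theta_d)}{\varphi}\frac{\langle\xi^*_0,\xi^*_0\rangle}{\langle\xi_0,\xi^*_0\rangle}\sum_{r=0}^dX_{d-r}E^*_0E_d\tau^*_{d-r}(A^*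 )\cdot\eta^*_{d-i}(A^* )\xi_0 &= X_i\xi^*_0,\\ \frac{\langle\xi^*_d,\xi^*_d\rangle}{\langle\xi_0,\xi^*_d\rangle}\sum_{r=0}^d\frac{X_{d-r}E^*_d\tau_r(A)}{\phi_d\phi_{d-1}\cdots\phi_{d-r+1}}\cdot\eta^*_{d-i}(A^* )\xi_0 &= X_i\xi^*_d. \end{align*} (ii) Let $\{X_i\}_{i=0}^d$ denote one of the sequences $\{E^*_i\}_{i=0}^d$, $\{E^*_{d-i}\}_{i=0}^d$, $\{\tau^*_i(A^* )\}_{i=0}^d$, $\{\tau^*_{d-i}(A^* )\}_{i=0}^d$, $\{\eta^*_i(A^* )\}_{i=0}^d$, $\{\eta^*_{d-i}(A^* )\}_{i=0}^d$. Then for $0\le i\le d$, \begin{align*} \frac{1}{\mathrm{tr}(E_0E^*_d)}\sum_{r=0}^d\frac{X_rE_0E^*_d\tau_r(A)}{\phi_d\phi_{d-1}\cdots\phi_{d-r+1}}\cdot\eta^*_i(A^* )\xi_0 &= X_i\xi_0,\\ \frac{\tau_d(\theta_d)}{\phi}\frac{\langle\xi_d,\xi^*_d\rangle}{\langle\xi_0,\xi^*_d\rangle}\sum_{r=0}^dX_rE_d\tau^*_{d-r}(A^* )\cdot\eta^*_i(A^* )\xi_0 &= X_i\xi_d,\\ \frac{1}{\mathrm{tr}(E_0E^*_d)}\sum_{r=0}^d\frac{X_{d-r}E_0E^*_d\tau_r(A)}{\phi_d\phi_{d-1}\cdots\phi_{d-r+1}}\cdot\eta^*_{d-i}(A^*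 )\xi_0 &= X_i\xi_0,\\ \frac{\tau_d(\theta_d)}{\phi}\frac{\langle\xi_d,\xi^*_d\rangle}{\langle\xi_0,\xi^*_d\rangle}\sum_{r=0}^dX_{d-r}E_d\tau^*_{d-r}(A^* )\cdot\eta^*_{d-i}(A^* )\xi_0 &= X_i\xi_d. \end{align*}
   Context: Let $\mathbb{K}$ be a field, $d\ge 0$ an integer, $\mathcal{A}$ a $\mathbb{K}$-algebra isomorphic to the algebra $\mathrm{Mat}_{d+1}(\mathbb{K})$ of all $(d+1)\times(d+1)$ matrices over $\mathbb{K}$, $I$ its identity, and $V$ an irreducible left $\mathcal{A}$-module (so $\dim V=d+1$). For $X\in\mathcal{A}$, $\mathrm{tr}(X)$ is the trace of $X$ (equivalently of its action on $V$). Leonard system. An element of $\mathcal{A}$ is multiplicity-free if it has $d+1$ mutually distinct eigenvalues in $\mathbb{K}$. If $A$ is multiplicity-free with eigenvalues $\theta_0,\dots,\theta_d$, the primitive idempotent of $A$ associated with $\theta_i$ is $E_i=\prod_{0\le j\le d,\,j\ne i}\frac{A-\theta_jI}{\theta_i-\theta_j}$ (the projection onto the one-dimensional $\theta_i$-eigenspace $E_iV$). A Leonard system in $\mathcal{A}$ is a sequence $\Phi=(A;\{E_i\}_{i=0}^d;A^*;\{E^*_i\}_{i=0}^d)$ such that: (i) each of $A,A^*$ is a multiplicity-free element of $\mathcal{A}$ ($A^*$ is just another element; no adjoint is meant); (ii) $\{E_i\}_{i=0}^d$ is an ordering of the primitive idempotents of $A$; (iii) $\{E^*_i\}_{i=0}^d$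 is an ordering of the primitive idempotents of $A^*$; (iv) for $0\le i,j\le d$, $E_iA^*E_j=0$ if $|i-j|>1$ and $E_iA^*E_j\ne0$ if $|i-j|=1$; (v) for $0\le i,j\le d$, $E^*_iAE^*_j=0$ if $|i-j|>1$ and $E^*_iAE^*_j\neq0$ if $|i-j|=1$. Parameter array. $\theta_i$ (resp. $\theta^*_i$) is the eigenvalue of $A$ (resp. $A^*$) associated with $E_i$ (resp. $E^*_i$). For $0\le i\le d$ define polynomials $\tau_i=(\lambda-\theta_0)(\lambda-\theta_1)\cdots(\lambda-\theta_{i-1})$, $\eta_i=(\lambda-\theta_d)(\lambda-\theta_{d-1})\cdots(\lambda-\theta_{d-i+1})$, $\tau^*_i=(\lambda-\theta^*_0)(\lambda-\theta^*_1)\cdots(\lambda-\theta^*_{i-1})$, $\eta^*_i=(\lambda-\theta^*_d)(\lambda-\theta^*_{d-1})\cdots(\lambda-\theta^*_{d-i+1})$. For $1\le i\le d$ define $\varphi_i=(\theta^*_0-\theta^*_i)\frac{\mathrm{tr}(\tau_i(A)E^*_0)}{\mathrm{tr}(\tau_{i-1}(A)E^*_0)}$ and $\phi_i=(\theta^*_0-\theta^*_i)\frac{\mathrm{tr}(\eta_i(A)E^*_0)}{\mathrm{tr}(\eta_{i-1}(A)E^*_0)}$; the denominators, and all $\varphi_i,\phi_i$, are known to be nonzero. The parameter array of $\Phi$ is $(\{\theta_i\}_{i=0}^d;\{\theta^*_i\}_{i=0}^d;\{\varphi_i\}_{i=1}^d;\{\phi_i\}_{i=1}^d)$. Abbreviate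 $\varphi=\varphi_1\varphi_2\cdots\varphi_d$ and $\phi=\phi_1\phi_2\cdots\phi_d$. Empty products are $1$. Bilinear form. There is a unique antiautomorphism $\dagger$ of $\mathcal{A}$ ($\mathbb{K}$-linear bijection with $(XY)^\dagger=Y^\dagger X^\dagger$) with $A^\dagger=A$ and $A^{*\dagger}=A^*$. $\langle\,,\rangle$ denotes a fixed nonzero bilinear form on $V$ with $\langle Xu,v\rangle=\langle u,X^\dagger v\rangle$ for all $X\in\mathcal{A}$, $u,v\in V$; it exists, is unique up to a nonzero scalar factor, and is nondegenerate and symmetric. All scalars appearing in denominators (traces and inner products) are known to be nonzero. The notation $T\cdot v$ means the element $T\in\mathcal{A}$ (including the scalar prefactor and the whole sum) applied to $v\in V$. *)

theory Defs
  imports "Jordan_Normal_Form.Matrix" "HOL-Computational_Algebra.Polynomial"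
begin

locale field_algebra = vector_space sA
  for sA :: "'k::field \<Rightarrow> 'a::ring_1 \<Rightarrow> 'a" +
  assumes scale_mult_left: "sA c x * y = sA c (x * y)"
    and scale_mult_right: "x * sA c y = sA c (x * y)"

definition matrix_trace :: "'k::comm_monoid_add mat \<Rightarrow> 'k" where
  "matrix_trace M = (\<Sum>i<dim_row M. M $$ (i, i))"

definition matrix_algebra_iso ::
  "nat \<Rightarrow> ('k::field \<Rightarrow> 'a::ring_1 \<Rightarrow> 'a) \<Rightarrow> ('a \<Rightarrow> 'k mat) \<Rightarrow> bool" where
  "matrix_algebra_iso n sA \<rho> \<longleftrightarrow>
     bij_betw \<rho> UNIV (carrier_mat n n) \<and>
     (\<forall>x y. \<rho> (x + y) = \<rho> x + \<rho> y) \<and>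
     (\<forall>x y. \<rho> (x * y) = \<rho> x * \<rho> y) \<and>
     \<rho> 1 = 1\<^sub>m n \<and>
     (\<forall>c x. \<rho> (sA c x) = c \<cdot>\<^sub>m \<rho> x)"

text \<open>The trace on an abstract matrix algebra, computed through an isomorphism \<open>\<rho>\<close> onto the
  concrete matrix algebra; by the Skolem--Noether theorem the value does not depend on the
  choice of \<open>\<rho>\<close>.\<close>

definition alg_trace :: "('a \<Rightarrow> 'k::comm_monoid_add mat) \<Rightarrow> 'a \<Rightarrow> 'k" where
  "alg_trace \<rho> x = matrix_trace (\<rho> x)"

locale algebra_module = field_algebra sA + V: vector_space sV
  for sA :: "'k::field \<Rightarrow> 'a::ring_1 \<Rightarrow> 'a"
    and sV :: "'k \<Rightarrow> 'v::ab_group_add \<Rightarrow> 'v" +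
  fixes act :: "'a \<Rightarrow> 'v \<Rightarrow> 'v"
  assumes act_add_left: "act (x + y) v = act x v + act y v"
    and act_add_right: "act x (v + w) = act x v + act x w"
    and act_mult: "act (x * y) v = act x (act y v)"
    and act_one: "act 1 v = v"
    and act_scale: "act (sA c x) v = sV c (act x v)"

definition is_submodule :: "('a \<Rightarrow> 'v::ab_group_add \<Rightarrow> 'v) \<Rightarrow> 'v set \<Rightarrow> bool" where
  "is_submodule act W \<longleftrightarrow>
     0 \<in> W \<and> (\<forall>v\<in>W. \<forall>w\<in>W. v + w \<in> W) \<and> (\<forall>x. \<forall>v\<in>W. act x v \<in> W)"

definition irreducible_module :: "('a \<Rightarrow> 'v::ab_group_add \<Rightarrow> 'v) \<Rightarrow> bool" where
  "irreducible_module act \<longleftrightarrow>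
     (\<exists>v::'v. v \<noteq> 0) \<and> (\<forall>W. is_submodule act W \<longrightarrow> W = {0} \<or> W = UNIV)"

definition eigenvalues ::
  "('k \<Rightarrow> 'v::ab_group_add \<Rightarrow> 'v) \<Rightarrow> ('a \<Rightarrow> 'v \<Rightarrow> 'v) \<Rightarrow> 'a \<Rightarrow> 'k set" where
  "eigenvalues sV act x = {t. \<exists>v. v \<noteq> 0 \<and> act x v = sV t v}"

definition multiplicity_free ::
  "nat \<Rightarrow> ('k \<Rightarrow> 'v::ab_group_add \<Rightarrow> 'v) \<Rightarrow> ('a \<Rightarrow> 'v \<Rightarrow> 'v) \<Rightarrow> 'a \<Rightarrow> bool" where
  "multiplicity_free d sV act x \<longleftrightarrow> card (eigenvalues sV act x) = d + 1"

text \<open>A list product is used because the algebra is not commutative; the factors are polynomials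
  in \<open>x\<close>, so their order is immaterial.\<close>

definition primitive_idempotent ::
  "nat \<Rightarrow> ('k::field \<Rightarrow> 'a::ring_1 \<Rightarrow> 'a) \<Rightarrow> 'a \<Rightarrow> (nat \<Rightarrow> 'k) \<Rightarrow> nat \<Rightarrow> 'a" where
  "primitive_idempotent d sA x \<theta> i =
     prod_list (map (\<lambda>j. sA (1 / (\<theta> i - \<theta> j)) (x - sA (\<theta> j) 1))
       (filter (\<lambda>j. j \<noteq> i) [0..<d + 1]))"

text \<open>\<open>E\<^sub>0, \<dots>, E\<^sub>d\<close> is an ordering of the primitive idempotents of \<open>x\<close>, and \<open>\<theta>\<^sub>i\<close> is the eigenvalue
  of \<open>x\<close> associated with \<open>E\<^sub>i\<close>. Here and below, sequences indexed by \<open>0, \<dots>, d\<close> (or \<open>1, \<dots>, d\<close>) are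
  functions on \<^typ>\<open>nat\<close> whose values at other indices are irrelevant.\<close>

definition idempotent_ordering ::
  "nat \<Rightarrow> ('k::field \<Rightarrow> 'a::ring_1 \<Rightarrow> 'a) \<Rightarrow> ('k \<Rightarrow> 'v::ab_group_add \<Rightarrow> 'v) \<Rightarrow> ('a \<Rightarrow> 'v \<Rightarrow> 'v) \<Rightarrow>
   'a \<Rightarrow> (nat \<Rightarrow> 'a) \<Rightarrow> (nat \<Rightarrow> 'k) \<Rightarrow> bool" where
  "idempotent_ordering d sA sV act x E \<theta> \<longleftrightarrow>
     bij_betw \<theta> {0..d} (eigenvalues sV act x) \<and>
     (\<forall>i\<le>d. E i = primitive_idempotent d sA x \<theta> i)"

definition leonard_system ::
  "nat \<Rightarrow> ('k::field \<Rightarrow> 'a::ring_1 \<Rightarrow> 'a) \<Rightarrow> ('k \<Rightarrow> 'v::ab_group_add \<Rightarrow> 'v) \<Rightarrow> ('a \<Rightarrow> 'v \<Rightarrow> 'v) \<Rightarrow>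
   'a \<Rightarrow> (nat \<Rightarrow> 'a) \<Rightarrow> 'a \<Rightarrow> (nat \<Rightarrow> 'a) \<Rightarrow> bool" where
  "leonard_system d sA sV act A E As Es \<longleftrightarrow>
     multiplicity_free d sV act A \<and> multiplicity_free d sV act As \<and>
     (\<exists>\<theta>. idempotent_ordering d sA sV act A E \<theta>) \<and>
     (\<exists>\<theta>s. idempotent_ordering d sA sV act As Es \<theta>s) \<and>
     (\<forall>i\<le>d. \<forall>j\<le>d.
        (\<bar>int i - int j\<bar> > 1 \<longrightarrow> E i * As * E j = 0) \<and>
        (\<bar>int i - int j\<bar> = 1 \<longrightarrow> E i * As * E j \<noteq> 0)) \<and>
     (\<forall>i\<le>d. \<forall>j\<le>d.
        (\<bar>int i - int j\<bar> > 1 \<longrightarrow> Es i * A * Es j = 0) \<and>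
        (\<bar>int i - int j\<bar> = 1 \<longrightarrow> Es i * A * Es j \<noteq> 0))"

definition alg_eval :: "('k::zero \<Rightarrow> 'a::ring_1 \<Rightarrow> 'a) \<Rightarrow> 'k poly \<Rightarrow> 'a \<Rightarrow> 'a" where
  "alg_eval sA p x = (\<Sum>n\<le>degree p. sA (coeff p n) (x ^ n))"

text \<open>\<open>tau \<theta> i\<close> and \<open>eta d \<theta> i\<close> are the monic polynomials of degree \<open>i\<close> with roots
  \<open>\<theta>\<^sub>0, \<dots>, \<theta>\<^bsub>i-1\<^esub>\<close> and \<open>\<theta>\<^sub>d, \<dots>, \<theta>\<^bsub>d-i+1\<^esub>\<close>; applied to the dual eigenvalues they give
  the starred polynomials.\<close>

definition tau :: "(nat \<Rightarrow> 'k::field) \<Rightarrow> nat \<Rightarrow> 'k poly" where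
  "tau \<theta> i = (\<Prod>j<i. [:- \<theta> j, 1:])"

definition eta :: "nat \<Rightarrow> (nat \<Rightarrow> 'k::field) \<Rightarrow> nat \<Rightarrow> 'k poly" where
  "eta d \<theta> i = (\<Prod>j<i. [:- \<theta> (d - j), 1:])"

text \<open>\<open>vphi\<close> is the first split sequence (LaTeX varphi, built from the polynomials \<open>\<tau>\<^sub>i\<close>), \<open>phi\<close> the
  second one (LaTeX phi, built from \<open>\<eta>\<^sub>i\<close>).\<close>

definition parameter_array ::
  "nat \<Rightarrow> ('k::field \<Rightarrow> 'a::ring_1 \<Rightarrow> 'a) \<Rightarrow> ('k \<Rightarrow> 'v::ab_group_add \<Rightarrow> 'v) \<Rightarrow> ('a \<Rightarrow> 'v \<Rightarrow> 'v) \<Rightarrow>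
   ('a \<Rightarrow> 'k mat) \<Rightarrow> 'a \<Rightarrow> (nat \<Rightarrow> 'a) \<Rightarrow> 'a \<Rightarrow> (nat \<Rightarrow> 'a) \<Rightarrow>
   (nat \<Rightarrow> 'k) \<Rightarrow> (nat \<Rightarrow> 'k) \<Rightarrow> (nat \<Rightarrow> 'k) \<Rightarrow> (nat \<Rightarrow> 'k) \<Rightarrow> bool" where
  "parameter_array d sA sV act \<rho> A E As Es \<theta> \<theta>s vphi phi \<longleftrightarrow>
     idempotent_ordering d sA sV act A E \<theta> \<and>
     idempotent_ordering d sA sV act As Es \<theta>s \<and>
     (\<forall>i\<in>{1..d}. vphi i = (\<theta>s 0 - \<theta>s i) *
        (alg_trace \<rho> (alg_eval sA (tau \<theta> i) A * Es 0) /
         alg_trace \<rho> (alg_eval sA (tau \<theta> (i - 1)) A * Es 0))) \<and>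
     (\<forall>i\<in>{1..d}. phi i = (\<theta>s 0 - \<theta>s i) *
        (alg_trace \<rho> (alg_eval sA (eta d \<theta> i) A * Es 0) /
         alg_trace \<rho> (alg_eval sA (eta d \<theta> (i - 1)) A * Es 0)))"

definition antiautomorphism :: "('k::field \<Rightarrow> 'a::ring_1 \<Rightarrow> 'a) \<Rightarrow> ('a \<Rightarrow> 'a) \<Rightarrow> bool" where
  "antiautomorphism sA dag \<longleftrightarrow>
     Vector_Spaces.linear sA sA dag \<and> bij dag \<and> (\<forall>x y. dag (x * y) = dag y * dag x)"

definition bilinear_form ::
  "('k::field \<Rightarrow> 'v::ab_group_add \<Rightarrow> 'v) \<Rightarrow> ('v \<Rightarrow> 'v \<Rightarrow> 'k) \<Rightarrow> bool" where
  "bilinear_form sV B \<longleftrightarrow>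
     (\<forall>v. Vector_Spaces.linear sV (*) (\<lambda>u. B u v)) \<and> (\<forall>u. Vector_Spaces.linear sV (*) (B u))"

end

theory Submission
  imports Defs
begin

text \<open>In each of the eight identities the factor standing to the right of \<open>X\<^sub>r\<close> is an operator \<open>T\<^sub>r\<close>, and the
whole content is that \<open>T\<^sub>r\<close> sends the vector \<open>\<eta>*\<^sub>i(A*) \<xi>\<^sub>0\<close> to \<open>0\<close> for \<open>r \<noteq> i\<close> and to a multiple
of a fixed vector for \<open>r = i\<close>. The sum then collapses to \<open>X\<^sub>i\<close> applied to that vector
(\<open>act_sum_single\<close>). Replacing \<open>X\<^sub>r\<close> by \<open>X\<^bsub>d-r\<^esub>\<close> and \<open>i\<close> by \<open>d - i\<close> turns the
first two identities of each group into the last two.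

The vanishing for \<open>r \<noteq> i\<close> is a degree count. Since \<open>E\<^sub>i A* E\<^sub>j = 0\<close> for \<open>\<bar>i - j\<bar> > 1\<close>, a polynomial \<open>p\<close>
satisfies \<open>E\<^sub>i p(A*) E\<^sub>j = 0\<close> whenever \<open>deg p < \<bar>i - j\<bar>\<close>, and if equality holds then \<open>E\<^sub>i p(A*) E\<^sub>j\<close> depends
only on the leading coefficient of \<open>p\<close> (\<open>eval_band\<close>, \<open>eval_band_edge\<close>). For \<open>E\<^sub>d \<tau>*\<^bsub>d-r\<^esub>(A*)\<close> the
degree is too small when \<open>i < r\<close>, and the product \<open>\<tau>*\<^bsub>d-r\<^esub> \<eta>*\<^sub>i\<close> vanishes at every \<open>\<theta>*\<^sub>j\<close> when
\<open>i > r\<close> (\<open>top_component_dual\<close>). For \<open>E*\<^sub>d \<tau>\<^sub>r(A)\<close> one uses that \<open>\<eta>*\<^sub>i(A*) \<xi>\<^sub>0\<close> lies in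
\<open>(E\<^sub>0V + \<dots> + E\<^sub>iV) \<inter> (E*\<^sub>0V + \<dots> + E*\<^bsub>d-i\<^esub>V)\<close> (\<open>top_component_tau_eta\<close>).

The constants for \<open>r = i\<close> come from one fact about these intersections, \<open>split_component_nonzero\<close>:
a nonzero vector of \<open>(E\<^sub>0V + \<dots> + E\<^bsub>d-m\<^esub>V) \<inter> (E*\<^sub>0V + \<dots> + E*\<^sub>mV)\<close> has a nonzero component in \<open>E*\<^sub>0V\<close>.
So such an intersection has dimension at most one, and \<open>\<eta>*\<^sub>r(A*) \<xi>\<^sub>0\<close> and \<open>\<eta>\<^bsub>d-r\<^esub>(A) \<xi>*\<^sub>0\<close> are
parallel (\<open>eta_vectors_parallel\<close>); comparing their components in \<open>E*\<^sub>0V\<close> gives the factor between them. It also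
shows that the traces in the definition of the split sequences do not vanish, so the products of
the \<open>phi\<^sub>j\<close> and of the \<open>vphi\<^sub>j\<close> telescope to a product of differences \<open>\<theta>*\<^sub>0 - \<theta>*\<^sub>j\<close> times one
quotient of traces, which is the factor found. The traces enter through \<open>E x E = tr(x E) E\<close> for an idempotent \<open>E\<close> of rank one.

Finally, a form for which \<open>A\<close> and \<open>A*\<close> are self-adjoint makes their eigenspaces orthogonal, so
\<open>E*\<^sub>0 u = (\<langle>u, \<xi>*\<^sub>0\<rangle> / \<langle>\<xi>*\<^sub>0, \<xi>*\<^sub>0\<rangle>) \<xi>*\<^sub>0\<close>; this is where the quotients of inner products come from.\<close>

section \<open>Evaluating polynomials at an element of an algebra\<close>

context field_algebra
begin

lemma alg_eval_eq_sum:
  assumes "degree p \<le> N"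
  shows "alg_eval sA p x = (\<Sum>n\<le>N. sA (coeff p n) (x ^ n))"
  unfolding alg_eval_def
  using assms by (intro sum.mono_neutral_left) (auto simp: coeff_eq_0)

lemma alg_eval_0 [simp]: "alg_eval sA 0 x = 0"
  by (simp add: alg_eval_def)

lemma alg_eval_1 [simp]: "alg_eval sA 1 x = 1"
  by (simp add: alg_eval_def)

lemma alg_eval_add: "alg_eval sA (p + q) x = alg_eval sA p x + alg_eval sA q x"
proof -
  define N where "N = max (degree p) (degree q)"
  have "degree p \<le> N" "degree q \<le> N" "degree (p + q) \<le> N"
    by (auto simp: N_def degree_add_le)
  then show ?thesis
    by (simp add: alg_eval_eq_sum scale_left_distrib sum.distrib)
qed

lemma alg_eval_smult: "alg_eval sA (smult c p) x = sA c (alg_eval sA p x)"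
  using degree_smult_le[of c p]
  by (simp add: alg_eval_eq_sum[of _ "degree p"] scale_sum_right)

lemma alg_eval_pCons: "alg_eval sA (pCons c p) x = sA c 1 + x * alg_eval sA p x"
proof -
  have "alg_eval sA (pCons c p) x
      = (\<Sum>n\<le>Suc (degree p). sA (coeff (pCons c p) n) (x ^ n))"
    by (intro alg_eval_eq_sum) (simp add: degree_pCons_le)
  also have "\<dots> = sA c 1 + (\<Sum>n\<le>degree p. sA (coeff p n) (x * x ^ n))"
    by (subst sum.atMost_Suc_shift) simp
  also have "(\<Sum>n\<le>degree p. sA (coeff p n) (x * x ^ n)) = x * alg_eval sA p x"
    by (simp add: alg_eval_def sum_distrib_left scale_mult_right)
  finally show ?thesis .
qed

lemma alg_eval_mult: "alg_eval sA (p * q) x = alg_eval sA p x * alg_eval sA q x"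
  by (induction p)
     (simp_all add: alg_eval_pCons alg_eval_add alg_eval_smult scale_mult_left
        distrib_right mult.assoc)

lemma alg_eval_eigen:
  assumes "x * e = sA t e"
  shows "alg_eval sA p x * e = sA (poly p t) e"
proof (induction p)
  case (pCons c p)
  then have "x * (alg_eval sA p x * e) = sA (poly p t) (x * e)"
    by (simp add: scale_mult_right)
  with assms show ?case
    by (simp add: alg_eval_pCons distrib_right mult.assoc scale_mult_left
        scale_left_distrib mult.commute)
qed simp

end

lemma degree_tau [simp]: "degree (tau \<theta> i) = i"
  unfolding tau_def by (subst degree_prod_eq_sum_degree) simp_all

lemma degree_eta [simp]: "degree (eta d \<theta> i) = i"
  unfolding eta_def by (subst degree_prod_eq_sum_degree) simp_all

lemma lead_coeff_tau [simp]: "coeff (tau \<theta> i) i = 1"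
  using lead_coeff_prod[of "\<lambda>j. [:- \<theta> j, 1:]" "{..<i}"] degree_tau[of \<theta> i]
  by (simp add: tau_def)

lemma lead_coeff_eta [simp]: "coeff (eta d \<theta> i) i = 1"
  using lead_coeff_prod[of "\<lambda>j. [:- \<theta> (d - j), 1:]" "{..<i}"] degree_eta[of d \<theta> i]
  by (simp add: eta_def)

lemma tau_nonzero [simp]: "tau \<theta> i \<noteq> 0"
  by (simp add: tau_def)

lemma eta_nonzero [simp]: "eta d \<theta> i \<noteq> 0"
  by (simp add: eta_def)

lemma poly_tau: "poly (tau \<theta> i) t = (\<Prod>j<i. t - \<theta> j)"
  by (simp add: tau_def poly_prod)

lemma poly_eta: "poly (eta d \<theta> i) t = (\<Prod>j<i. t - \<theta> (d - j))"
  by (simp add: eta_def poly_prod)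

lemma poly_tau_root: "j < i \<Longrightarrow> poly (tau \<theta> i) (\<theta> j) = 0"
  by (auto simp: poly_tau)

lemma poly_eta_root:
  assumes "j \<le> d" "d < i + j"
  shows "poly (eta d \<theta> i) (\<theta> j) = 0"
  using assms by (auto simp: poly_eta intro!: bexI[of _ "d - j"])

lemma poly_eta_reindex:
  assumes "i \<le> d"
  shows "poly (eta d \<theta> i) t = (\<Prod>j=d-i+1..d. t - \<theta> j)"
  unfolding poly_eta
  by (rule prod.reindex_bij_witness[of _ "\<lambda>j. d - j" "\<lambda>j. d - j"]) (use assms in auto)

context algebra_module
begin

lemma act_zero_right [simp]: "act x 0 = 0"
  using act_add_right[of x 0 0] by simp

lemma act_zero_left [simp]: "act 0 v = 0"
  using act_add_left[of 0 0 v] by simp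

lemma act_scale_right: "act x (sV c v) = sV c (act x v)"
proof -
  have "act x (sV c v) = act (x * sA c 1) v"
    by (simp add: act_mult act_scale act_one)
  then show ?thesis
    by (simp add: scale_mult_right act_scale)
qed

lemma act_sum_left: "act (\<Sum>i\<in>S. f i) v = (\<Sum>i\<in>S. act (f i) v)"
  by (induction S rule: infinite_finite_induct) (simp_all add: act_add_left)

lemma act_sum_right: "act x (\<Sum>i\<in>S. f i) = (\<Sum>i\<in>S. act x (f i))"
  by (induction S rule: infinite_finite_induct) (simp_all add: act_add_right)

lemma act_diff_left: "act (x - y) v = act x v - act y v"
  using act_add_left[of "x - y" y v] by (simp add: algebra_simps)

lemma act_diff_right: "act x (v - w) = act x v - act x w"
  using act_add_right[of x "v - w" w] by (simp add: algebra_simps)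

text \<open>The shape shared by all the identities to be proved: \<open>T\<close> behaves like a dual basis on \<open>v\<close>, and the
scalar \<open>c\<close> normalizes the surviving term.\<close>

lemma act_sum_single:
  fixes d i :: nat
  assumes "\<And>r. r \<le> d \<Longrightarrow> act (T r) v = (if r = i then z else 0)" "i \<le> d" "sV c z = u"
  shows "act (sA c (\<Sum>r=0..d. X r * T r)) v = act (X i) u"
proof -
  have "act (\<Sum>r=0..d. X r * T r) v = (\<Sum>r\<in>{i}. act (X r) (act (T r) v))"
    unfolding act_sum_left act_mult
    using assms by (intro sum.mono_neutral_right) auto
  then show ?thesis using assms by (auto simp: act_scale act_scale_right)
qed

end

section \<open>Coordinates of the irreducible module\<close>

text \<open>A basis \<open>w\<close> of the module in which every \<open>x\<close> acts by the matrix \<open>\<rho> x\<close>. It transports the trace,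
which is defined through \<open>\<rho>\<close>, to the module.\<close>

locale module_coordinates = algebra_module sA sV act
  for sA :: "'k::field \<Rightarrow> 'a::ring_1 \<Rightarrow> 'a"
    and sV :: "'k \<Rightarrow> 'v::ab_group_add \<Rightarrow> 'v"
    and act :: "'a \<Rightarrow> 'v \<Rightarrow> 'v" +
  fixes n :: nat and \<rho> :: "'a \<Rightarrow> 'k mat" and w :: "nat \<Rightarrow> 'v"
  assumes iso: "matrix_algebra_iso n sA \<rho>"
    and act_basis: "i < n \<Longrightarrow> act x (w i) = (\<Sum>j<n. sV (\<rho> x $$ (j, i)) (w j))"
    and basis_spans: "\<exists>c. v = (\<Sum>j<n. sV (c j) (w j))"
    and basis_independent: "(\<Sum>j<n. sV (c j) (w j)) = 0 \<Longrightarrow> i < n \<Longrightarrow> c i = 0"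

text \<open>Let \<open>e\<^sub>j\<^sub>k\<close> be the matrix units. As \<open>1\<close> is the sum of the \<open>e\<^sub>k\<^sub>k\<close>, some \<open>e\<^sub>k\<^sub>k v\<close> is nonzero, and then the
vectors \<open>e\<^sub>i\<^sub>k v\<close> span a submodule on which \<open>x\<close> acts by \<open>\<rho> x\<close>. By irreducibility this is everything.\<close>

lemma ex_module_coordinates:
  fixes sA :: "'k::field \<Rightarrow> 'a::ring_1 \<Rightarrow> 'a"
    and sV :: "'k \<Rightarrow> 'v::ab_group_add \<Rightarrow> 'v"
  assumes "algebra_module sA sV act" and irr: "irreducible_module act"
    and iso: "matrix_algebra_iso n sA \<rho>"
  shows "\<exists>w. module_coordinates sA sV act n \<rho> w"
proof -
  interpret algebra_module sA sV act by fact
  have bij: "bij_betw \<rho> UNIV (carrier_mat n n)"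
    and add: "\<rho> (x + y) = \<rho> x + \<rho> y" and mult: "\<rho> (x * y) = \<rho> x * \<rho> y"
    and one: "\<rho> 1 = 1\<^sub>m n" and scale: "\<rho> (sA c x) = c \<cdot>\<^sub>m \<rho> x" for x y c
    using iso by (auto simp: matrix_algebra_iso_def)
  have carrier [simp]: "\<rho> x \<in> carrier_mat n n" for x
    using bij by (auto simp: bij_betw_def)
  have dims [simp]: "dim_row (\<rho> x) = n" "dim_col (\<rho> x) = n" for x
    using carrier_matD[OF carrier] by auto
  have inj: "x = y" if "\<And>i j. i < n \<Longrightarrow> j < n \<Longrightarrow> \<rho> x $$ (i, j) = \<rho> y $$ (i, j)" for x y
  proof -
    have "\<rho> x = \<rho> y" using that by (intro eq_matI) auto
    then show ?thesis using bij by (auto simp: bij_betw_def inj_def)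
  qed
  have zero: "\<rho> 0 $$ (i, j) = 0" if "i < n" "j < n" for i j
  proof -
    have "\<rho> 0 $$ (i, j) = (0 \<cdot>\<^sub>m \<rho> 0) $$ (i, j)" using scale[of 0 0] by simp
    also have "\<dots> = 0" using that by (subst index_smult_mat) simp_all
    finally show ?thesis .
  qed
  have sum: "\<rho> (\<Sum>k\<in>S. f k) $$ (i, j) = (\<Sum>k\<in>S. \<rho> (f k) $$ (i, j))"
    if "i < n" "j < n" for i j :: nat and f and S :: "nat set"
    by (induction S rule: infinite_finite_induct) (use that in \<open>simp_all add: add zero\<close>)
  define e where "e j k = inv_into UNIV \<rho> (mat n n (\<lambda>p. if p = (j, k) then 1 else 0))" for j k
  have e: "\<rho> (e j k) = mat n n (\<lambda>p. if p = (j, k) then 1 else 0)" for j k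
    unfolding e_def using bij by (intro f_inv_into_f) (simp add: bij_betw_def)
  have mult_e: "x * e j k = (\<Sum>i<n. sA (\<rho> x $$ (i, j)) (e i k))" if "j < n" "k < n" for x j k
  proof (rule inj)
    fix i l assume "i < n" "l < n"
    then show "\<rho> (x * e j k) $$ (i, l) = \<rho> (\<Sum>i<n. sA (\<rho> x $$ (i, j)) (e i k)) $$ (i, l)"
      using that by (cases "l = k")
        (simp_all add: mult sum scale e scalar_prod_def if_distrib cong: if_cong)
  qed
  have one_e: "1 = (\<Sum>i<n. e i i)"
  proof (rule inj)
    fix i j assume "i < n" "j < n"
    then show "\<rho> 1 $$ (i, j) = \<rho> (\<Sum>i<n. e i i) $$ (i, j)"
    proof (cases "i = j")
      case False
      then have "(\<Sum>k<n. \<rho> (e k k) $$ (i, j)) = 0"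
        using \<open>i < n\<close> \<open>j < n\<close> by (intro sum.neutral) (simp add: e)
      with False \<open>i < n\<close> \<open>j < n\<close> show ?thesis by (simp add: one sum)
    qed (simp add: one sum e)
  qed
  obtain v0 :: 'v where v0: "v0 \<noteq> 0" using irr by (auto simp: irreducible_module_def)
  have "\<exists>k<n. act (e k k) v0 \<noteq> 0"
  proof (rule ccontr)
    assume "\<not> ?thesis"
    then have "act (\<Sum>i<n. e i i) v0 = 0"
      unfolding act_sum_left by (intro sum.neutral) simp
    with v0 show False by (simp add: act_one flip: one_e)
  qed
  then obtain k where k: "k < n" "act (e k k) v0 \<noteq> 0" by blast
  define w where "w i = act (e i k) v0" for i
  have act_w: "act x (w i) = (\<Sum>j<n. sV (\<rho> x $$ (j, i)) (w j))" if "i < n" for x i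
    using that k(1)
    by (simp add: w_def mult_e act_sum_left act_scale flip: act_mult)
  have spans: "\<exists>c. v = (\<Sum>j<n. sV (c j) (w j))" for v
  proof -
    let ?W = "range (\<lambda>c. \<Sum>j<n. sV (c j) (w j))"
    have "is_submodule act ?W"
      unfolding is_submodule_def
    proof (intro conjI ballI allI)
      show "0 \<in> ?W" by (intro image_eqI[of _ _ "\<lambda>_. 0"]) simp_all
    next
      fix u v assume "u \<in> ?W" "v \<in> ?W"
      then obtain a b where "u = (\<Sum>j<n. sV (a j) (w j))" "v = (\<Sum>j<n. sV (b j) (w j))"
        by auto
      then show "u + v \<in> ?W"
        by (intro image_eqI[of _ _ "\<lambda>j. a j + b j"])
           (simp_all add: V.scale_left_distrib sum.distrib)
    next
      fix x v assume "v \<in> ?W"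
      then obtain a where a: "v = (\<Sum>i<n. sV (a i) (w i))" by auto
      have "act x v = (\<Sum>i<n. \<Sum>j<n. sV (a i * \<rho> x $$ (j, i)) (w j))"
        by (simp add: a act_sum_right act_scale_right act_w V.scale_sum_right)
      also have "\<dots> = (\<Sum>j<n. sV (\<Sum>i<n. a i * \<rho> x $$ (j, i)) (w j))"
        by (subst sum.swap) (simp add: V.scale_sum_left)
      finally show "act x v \<in> ?W"
        by (intro image_eqI[of _ _ "\<lambda>j. \<Sum>i<n. a i * \<rho> x $$ (j, i)"]) simp_all
    qed
    moreover have "w k \<in> ?W"
      using k(1) by (intro image_eqI[of _ _ "\<lambda>j. if j = k then 1 else 0"])
        (simp_all add: if_distrib[of "\<lambda>c. sV c _"] cong: if_cong)
    moreover have "w k \<noteq> 0" using k by (simp add: w_def)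
    ultimately have "?W = UNIV" using irr unfolding irreducible_module_def by blast
    then have "v \<in> ?W" by simp
    then show ?thesis by blast
  qed
  have indep: "c i = 0" if c: "(\<Sum>j<n. sV (c j) (w j)) = 0" and i: "i < n" for c i
  proof -
    have act_e: "act (e k i) (w j) = (if j = i then w k else 0)" if "j < n" for j
      using that i k(1) by (simp add: act_w e if_distrib[of "\<lambda>c. sV c _"] cong: if_cong)
    have "0 = act (e k i) (\<Sum>j<n. sV (c j) (w j))" by (simp add: c)
    also have "\<dots> = (\<Sum>j<n. if j = i then sV (c i) (w k) else 0)"
      by (simp add: act_sum_right act_scale_right act_e if_distrib[of "sV _"] cong: if_cong)
    also have "\<dots> = sV (c i) (w k)" using i by simp
    finally show ?thesis using k by (simp add: w_def)
  qed
  have "module_coordinates sA sV act n \<rho> w"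
    by unfold_locales (fact iso, fact act_w, fact spans, fact indep)
  then show ?thesis by blast
qed

context module_coordinates
begin

lemma coordinates_unique:
  assumes "(\<Sum>j<n. sV (b j) (w j)) = (\<Sum>j<n. sV (c j) (w j))" "i < n"
  shows "b i = c i"
  using basis_independent[of "\<lambda>j. b j - c j" i] assms
  by (simp add: V.scale_left_diff_distrib sum_subtractf)

lemma carrier: "\<rho> x \<in> carrier_mat n n"
  using iso by (auto simp: matrix_algebra_iso_def bij_betw_def)

lemma act_faithful:
  assumes "\<And>v. act x v = act y v"
  shows "x = y"
proof -
  have "\<rho> x $$ (j, i) = \<rho> y $$ (j, i)" if "i < n" "j < n" for i j
    by (rule coordinates_unique[where b = "\<lambda>j. \<rho> x $$ (j, i)" and c = "\<lambda>j. \<rho> y $$ (j, i)"])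
       (use assms[of "w i"] that in \<open>simp_all add: act_basis\<close>)
  then have "\<rho> x = \<rho> y" using carrier[of x] carrier[of y] by (intro eq_matI) auto
  then show ?thesis using iso by (auto simp: matrix_algebra_iso_def bij_betw_def inj_def)
qed

text \<open>If \<open>e v = l(v) f\<close> for a linear functional \<open>l\<close>, then \<open>x e\<close> is the rank one operator \<open>l(-) x f\<close>, whose trace
\<open>l(x f)\<close> is also the coefficient of \<open>f\<close> in \<open>e x f\<close>.\<close>

lemma compression_eq_trace:
  assumes rank1: "\<And>v. \<exists>c. act e v = sV c f"
  shows "act (e * x) f = sV (alg_trace \<rho> (x * e)) f"
proof -
  have "\<exists>l. \<forall>j. act e (w j) = sV (l j) f" by (intro choice allI rank1)
  then obtain l where l: "act e (w j) = sV (l j) f" for j by blast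
  obtain h where h: "act x f = (\<Sum>j<n. sV (h j) (w j))" using basis_spans by blast
  have diag: "\<rho> (x * e) $$ (i, i) = l i * h i" if "i < n" for i
  proof (rule coordinates_unique[where b = "\<lambda>j. \<rho> (x * e) $$ (j, i)" and c = "\<lambda>j. l i * h j"])
    have "act (x * e) (w i) = sV (l i) (\<Sum>j<n. sV (h j) (w j))"
      by (simp add: act_mult l act_scale_right h)
    then show "(\<Sum>j<n. sV (\<rho> (x * e) $$ (j, i)) (w j)) = (\<Sum>j<n. sV (l i * h j) (w j))"
      using that by (simp add: act_basis V.scale_sum_right)
  qed fact
  have "act (e * x) f = (\<Sum>j<n. sV (h j) (sV (l j) f))"
    by (simp add: act_mult h act_sum_right act_scale_right l)
  also have "\<dots> = sV (\<Sum>j<n. l j * h j) f"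
    by (simp add: V.scale_sum_left mult.commute)
  also have "(\<Sum>j<n. l j * h j) = alg_trace \<rho> (x * e)"
    using diag carrier[of "x * e"] by (simp add: alg_trace_def matrix_trace_def)
  finally show ?thesis .
qed

end

section \<open>Resolutions of the identity by eigenprojections\<close>

text \<open>What is needed of a multiplicity-free element \<open>A\<close> with its primitive idempotents: a resolution of
the identity into eigenprojections with one-dimensional images. The functional \<open>tr\<close> is the
trace; the compression rule expresses that the \<open>E\<^sub>i\<close> have rank one.\<close>

locale eigenframe = algebra_module sA sV act
  for sA :: "'k::field \<Rightarrow> 'a::ring_1 \<Rightarrow> 'a"
    and sV :: "'k \<Rightarrow> 'v::ab_group_add \<Rightarrow> 'v"
    and act :: "'a \<Rightarrow> 'v \<Rightarrow> 'v" +
  fixes d :: nat and A :: 'a and E :: "nat \<Rightarrow> 'a" and \<theta> :: "nat \<Rightarrow> 'k" and tr :: "'a \<Rightarrow> 'k"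
  assumes orthogonal: "i \<le> d \<Longrightarrow> j \<le> d \<Longrightarrow> E i * E j = (if i = j then E i else 0)"
    and resolution: "(\<Sum>i\<le>d. E i) = 1"
    and eigen: "i \<le> d \<Longrightarrow> A * E i = sA (\<theta> i) (E i)"
    and inj_eigenvalues: "inj_on \<theta> {..d}"
    and line: "i \<le> d \<Longrightarrow> act (E i) v \<noteq> 0 \<Longrightarrow> \<exists>c. act (E i) u = sV c (act (E i) v)"
    and compression: "i \<le> d \<Longrightarrow> E i * x * E i = sA (tr (x * E i)) (E i)"
begin

lemma idempotent: "i \<le> d \<Longrightarrow> E i * E i = E i"
  by (simp add: orthogonal)

lemma eval_idempotent: "i \<le> d \<Longrightarrow> alg_eval sA p A * E i = sA (poly p (\<theta> i)) (E i)"
  by (intro alg_eval_eigen eigen)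

lemma eval_eq_sum: "alg_eval sA p A = (\<Sum>i\<le>d. sA (poly p (\<theta> i)) (E i))"
proof -
  have "alg_eval sA p A = (\<Sum>i\<le>d. alg_eval sA p A * E i)"
    by (simp add: resolution flip: sum_distrib_left)
  then show ?thesis by (simp add: eval_idempotent)
qed

lemma idempotent_eval: "i \<le> d \<Longrightarrow> E i * alg_eval sA p A = sA (poly p (\<theta> i)) (E i)"
  by (simp add: eval_eq_sum sum_distrib_left scale_mult_right orthogonal
      if_distrib[of "sA _"] cong: if_cong)

lemma eval_eq_single:
  assumes "i \<le> d" "\<And>j. j \<le> d \<Longrightarrow> j \<noteq> i \<Longrightarrow> poly p (\<theta> j) = 0"
  shows "alg_eval sA p A = sA (poly p (\<theta> i)) (E i)"
  unfolding eval_eq_sum using assms by (subst sum.remove[of _ i]) simp_all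

lemma eval_eq_0:
  assumes "\<And>j. j \<le> d \<Longrightarrow> poly p (\<theta> j) = 0"
  shows "alg_eval sA p A = 0"
  unfolding eval_eq_sum using assms by simp

lemma sum_components: "v = (\<Sum>i\<le>d. act (E i) v)"
  by (simp add: resolution act_one flip: act_sum_left)

lemma ex_component_nonzero: "v \<noteq> 0 \<Longrightarrow> \<exists>i\<le>d. act (E i) v \<noteq> 0"
  by (subst (asm) sum_components[of v]) (auto dest: sum.not_neutral_contains_not_neutral)

text \<open>The axioms do not see the order of the eigenvalues. Running the list backwards exchanges the
polynomials \<open>tau\<close> and \<open>eta\<close>, so facts about one transfer to the other.\<close>

lemma reversed: "eigenframe sA sV act d A (\<lambda>i. E (d - i)) (\<lambda>i. \<theta> (d - i)) tr"
proof unfold_locales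
  have "(\<Sum>i\<le>d. E (d - i)) = (\<Sum>i\<le>d. E i)"
    by (rule sum.reindex_bij_witness[of _ "\<lambda>i. d - i" "\<lambda>i. d - i"]) auto
  then show "(\<Sum>i\<le>d. E (d - i)) = 1" by (simp add: resolution)
  show "inj_on (\<lambda>i. \<theta> (d - i)) {..d}"
    by (intro inj_onI) (use inj_eigenvalues in \<open>force simp: inj_on_def\<close>)
  show "\<exists>c. act (E (d - i)) u = sV c (act (E (d - i)) v)"
    if "act (E (d - i)) v \<noteq> 0" for i u v
    using that by (intro line) auto
qed (auto simp: orthogonal eigen compression)

end

context module_coordinates
begin

text \<open>Choose an eigenvector \<open>f\<^sub>i\<close> for each \<open>\<theta>\<^sub>i\<close>. The products defining the \<open>E\<^sub>i\<close> show \<open>E\<^sub>i f\<^sub>j = 0\<close> for \<open>i \<noteq> j\<close>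
and \<open>E\<^sub>i f\<^sub>i = f\<^sub>i\<close>, so the \<open>d + 1\<close> vectors \<open>f\<^sub>i\<close> are independent and hence a basis. All claims can be
checked on this basis because the action is faithful.\<close>

lemma trace_eigenframe:
  assumes ord: "idempotent_ordering d sA sV act A E \<theta>" and n: "n = d + 1"
  shows "eigenframe sA sV act d A E \<theta> (alg_trace \<rho>)"
proof -
  have inj: "inj_on \<theta> {..d}" and ev: "\<theta> ` {..d} = eigenvalues sV act A"
    using ord by (auto simp: idempotent_ordering_def bij_betw_def atLeast0AtMost)
  have E: "E i = primitive_idempotent d sA A \<theta> i" if "i \<le> d" for i
    using ord that by (auto simp: idempotent_ordering_def)
  have "\<forall>i\<in>{..d}. \<exists>v. v \<noteq> 0 \<and> act A v = sV (\<theta> i) v"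
    using ev by (auto simp: eigenvalues_def)
  then obtain f where f: "\<And>i. i \<le> d \<Longrightarrow> f i \<noteq> 0" "\<And>i. i \<le> d \<Longrightarrow> act A (f i) = sV (\<theta> i) (f i)"
    by (metis atMost_iff)
  have act_prod: "act (prod_list (map (\<lambda>k. sA (1 / (\<theta> i - \<theta> k)) (A - sA (\<theta> k) 1)) ks)) (f j)
      = sV (prod_list (map (\<lambda>k. (\<theta> j - \<theta> k) / (\<theta> i - \<theta> k)) ks)) (f j)" if "j \<le> d" for i j ks
    by (induction ks)
       (simp_all add: act_one act_mult act_scale act_scale_right act_diff_left f(2)[OF that]
          mult.commute flip: V.scale_left_diff_distrib)
  have act_E: "act (E i) (f j) = (if i = j then f j else 0)" if "i \<le> d" "j \<le> d" for i j
  proof -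
    let ?ks = "filter (\<lambda>k. k \<noteq> i) [0..<d + 1]"
    let ?c = "prod_list (map (\<lambda>k. (\<theta> j - \<theta> k) / (\<theta> i - \<theta> k)) ?ks)"
    have "?c = (if i = j then 1 else 0)"
    proof (cases "i = j")
      case True
      have "map (\<lambda>k. (\<theta> j - \<theta> k) / (\<theta> i - \<theta> k)) ?ks = map (\<lambda>k. 1) ?ks"
      proof (intro map_cong refl)
        fix k assume "k \<in> set ?ks"
        then have k: "k \<le> d" "k \<noteq> i" by (simp_all del: upt_Suc)
        then have "\<theta> i \<noteq> \<theta> k" using inj_onD[OF inj, of i k] that by auto
        then show "(\<theta> j - \<theta> k) / (\<theta> i - \<theta> k) = 1" using True by simp
      qed
      then show ?thesis using True by (simp add: map_replicate_const prod_list_replicate)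
    next
      case False
      then have "j \<in> set ?ks" using that by (simp del: upt_Suc)
      then have "0 \<in> set (map (\<lambda>k. (\<theta> j - \<theta> k) / (\<theta> i - \<theta> k)) ?ks)"
        unfolding set_map by (intro image_eqI[of _ _ j]) simp
      then have "?c = 0" by (simp only: prod_list_zero_iff)
      then show ?thesis by (simp only: if_not_P[OF False])
    qed
    then show ?thesis
      using that by (simp only: E primitive_idempotent_def act_prod) simp
  qed
  have inj_f: "inj_on f {..d}"
  proof (rule inj_onI, rule ccontr)
    fix i j assume ij: "i \<in> {..d}" "j \<in> {..d}" "f i = f j" "i \<noteq> j"
    then have "act (E i) (f i) = act (E i) (f j)" by simp
    then show False using ij f(1)[of i] act_E[of i i] act_E[of i j] by simp
  qed
  let ?F = "f ` {..d}"
  have coeff: "act (E i) (\<Sum>j\<le>d. sV (c j) (f j)) = sV (c i) (f i)" if "i \<le> d" for c i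
  proof -
    have "act (E i) (\<Sum>j\<le>d. sV (c j) (f j)) = (\<Sum>j\<le>d. if j = i then sV (c i) (f i) else 0)"
      unfolding act_sum_right using that
      by (intro sum.cong) (auto simp: act_scale_right act_E)
    then show ?thesis using that by simp
  qed
  have indep: "V.independent ?F"
  proof (rule V.independent_if_scalars_zero)
    fix c v assume "(\<Sum>x\<in>?F. sV (c x) x) = 0" "v \<in> ?F"
    then obtain i where i: "i \<le> d" "v = f i" "(\<Sum>j\<le>d. sV (c (f j)) (f j)) = 0"
      by (auto simp: sum.reindex[OF inj_f])
    then have "sV (c (f i)) (f i) = 0" using coeff[of i "\<lambda>j. c (f j)"] by simp
    then show "c v = 0" using i f(1) by simp
  qed simp
  have span: "v \<in> V.span ?F" for v
  proof (rule ccontr)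
    assume v: "v \<notin> V.span ?F"
    then have "V.independent (insert v ?F)" using indep by (simp add: V.independent_insert)
    moreover have "insert v ?F \<subseteq> V.span (w ` {..<n})"
    proof
      fix u
      obtain c where c: "u = (\<Sum>j<n. sV (c j) (w j))" using basis_spans by blast
      show "u \<in> V.span (w ` {..<n})"
        unfolding c by (rule V.span_sum, rule V.span_scale, rule V.span_base, rule imageI)
    qed
    ultimately have "card (insert v ?F) \<le> card (w ` {..<n})"
      using V.independent_span_bound[of "w ` {..<n}" "insert v ?F"] by simp
    also have "\<dots> \<le> n" using card_image_le[of "{..<n}" w] by simp
    finally have "card (insert v ?F) \<le> d + 1" unfolding n .
    moreover have "v \<notin> ?F" using v V.span_base[of v ?F] by auto
    then have "card (insert v ?F) = d + 2" using card_image[OF inj_f] by simp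
    ultimately show False by simp
  qed
  have expand: "\<exists>c. v = (\<Sum>j\<le>d. sV (c j) (f j))" for v
  proof -
    have "v \<in> range (\<lambda>c. \<Sum>x\<in>?F. sV (c x) x)"
      using span[of v] V.span_finite[of ?F] by simp
    then obtain c where "v = (\<Sum>x\<in>?F. sV (c x) x)" by blast
    then have "v = (\<Sum>j\<le>d. sV (c (f j)) (f j))" by (simp add: sum.reindex[OF inj_f])
    then show ?thesis by (rule exI[where P = "\<lambda>c. v = (\<Sum>j\<le>d. sV (c j) (f j))"])
  qed
  have eqI: "x = y" if "\<And>j. j \<le> d \<Longrightarrow> act x (f j) = act y (f j)" for x y
  proof (rule act_faithful)
    fix v
    obtain c where "v = (\<Sum>j\<le>d. sV (c j) (f j))" using expand by blast
    then show "act x v = act y v"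
      by (simp add: act_sum_right act_scale_right) (intro sum.cong refl, simp add: that)
  qed
  have rank1: "\<exists>c. act (E i) v = sV c (f i)" if "i \<le> d" for i v
  proof -
    obtain c where "v = (\<Sum>j\<le>d. sV (c j) (f j))" using expand by blast
    then have "act (E i) v = sV (c i) (f i)" using coeff[OF that] by simp
    then show ?thesis by blast
  qed
  show ?thesis
  proof unfold_locales
    show "E i * E j = (if i = j then E i else 0)" if "i \<le> d" "j \<le> d" for i j
      by (rule eqI) (use that in \<open>simp add: act_mult act_E\<close>)
    show "(\<Sum>i\<le>d. E i) = 1"
    proof (rule eqI)
      fix j assume j: "j \<le> d"
      then have "act (\<Sum>i\<le>d. E i) (f j) = (\<Sum>i\<le>d. if i = j then f j else 0)"
        unfolding act_sum_left by (intro sum.cong) (auto simp: act_E)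
      with j show "act (\<Sum>i\<le>d. E i) (f j) = act 1 (f j)" by (simp add: act_one)
    qed
    show "A * E i = sA (\<theta> i) (E i)" if "i \<le> d" for i
      by (rule eqI) (use that in \<open>simp add: act_mult act_scale act_E f\<close>)
    show "inj_on \<theta> {..d}" by (rule inj)
    show "\<exists>c. act (E i) u = sV c (act (E i) v)" if "i \<le> d" "act (E i) v \<noteq> 0" for i u v
    proof -
      note i = that(1)
      obtain a where "act (E i) v = sV a (f i)" using rank1[OF i] by blast
      moreover obtain b where "act (E i) u = sV b (f i)" using rank1[OF i] by blast
      ultimately have "act (E i) u = sV (b / a) (act (E i) v)" using that(2) by auto
      then show ?thesis by blast
    qed
    show "E i * x * E i = sA (alg_trace \<rho> (x * E i)) (E i)" if "i \<le> d" for i x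
    proof (rule eqI)
      fix j assume j: "j \<le> d"
      have tr: "act (E i) (act x (f i)) = sV (alg_trace \<rho> (x * E i)) (f i)"
        unfolding act_mult[symmetric] by (rule compression_eq_trace) (rule rank1[OF that])
      have E_f: "act (E i) (f j) = (if i = j then f i else 0)"
        using act_E[OF that j] by simp
      show "act (E i * x * E i) (f j) = act (sA (alg_trace \<rho> (x * E i)) (E i)) (f j)"
      proof (cases "i = j")
        case True
        show ?thesis unfolding act_mult act_scale E_f if_P[OF True] by (rule tr)
      next
        case False
        show ?thesis unfolding act_mult act_scale E_f if_not_P[OF False] by simp
      qed
    qed
  qed
qed

end

section \<open>Tridiagonal action\<close>

text \<open>One half of the Leonard condition: \<open>Y\<close> is irreducible tridiagonal in the eigenbasis of \<open>A\<close>.\<close>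

locale tridiagonal_frame = eigenframe sA sV act d A E \<theta> tr
  for sA :: "'k::field \<Rightarrow> 'a::ring_1 \<Rightarrow> 'a"
    and sV :: "'k \<Rightarrow> 'v::ab_group_add \<Rightarrow> 'v"
    and act :: "'a \<Rightarrow> 'v \<Rightarrow> 'v"
    and d A E \<theta> tr +
  fixes Y :: 'a
  assumes far: "i \<le> d \<Longrightarrow> j \<le> d \<Longrightarrow> \<bar>int i - int j\<bar> > 1 \<Longrightarrow> E i * Y * E j = 0"
    and adjacent: "i \<le> d \<Longrightarrow> j \<le> d \<Longrightarrow> \<bar>int i - int j\<bar> = 1 \<Longrightarrow> \<exists>v. act (E i * Y * E j) v \<noteq> 0"
begin

lemma power_Suc_decompose:
  "E i * Y ^ Suc n * E j = (\<Sum>k\<le>d. (E i * Y * E k) * (E k * Y ^ n * E j))"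
proof -
  have "E i * Y ^ Suc n * E j = E i * Y * (\<Sum>k\<le>d. E k * E k) * Y ^ n * E j"
    by (simp add: orthogonal resolution mult.assoc)
  then show ?thesis by (simp add: sum_distrib_left sum_distrib_right mult.assoc)
qed

text \<open>Each factor \<open>Y\<close> moves the index by at most one.\<close>

lemma power_band: "i \<le> d \<Longrightarrow> j \<le> d \<Longrightarrow> \<bar>int i - int j\<bar> > int n \<Longrightarrow> E i * Y ^ n * E j = 0"
proof (induction n arbitrary: i)
  case 0
  then show ?case by (auto simp: orthogonal)
next
  case (Suc n)
  have "(E i * Y * E k) * (E k * Y ^ n * E j) = 0" if "k \<le> d" for k
  proof (cases "\<bar>int i - int k\<bar> > 1")
    case True
    then show ?thesis using far[of i k] Suc.prems that by simp
  next
    case False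
    then have "E k * Y ^ n * E j = 0" using Suc.prems that by (intro Suc.IH) auto
    then show ?thesis by simp
  qed
  then show ?case unfolding power_Suc_decompose by (intro sum.neutral) auto
qed

lemma eval_band:
  assumes "i \<le> d" "j \<le> d" "\<bar>int i - int j\<bar> > int (degree p)"
  shows "E i * alg_eval sA p Y * E j = 0"
  using assms power_band[of i j]
  by (simp add: alg_eval_def sum_distrib_left sum_distrib_right scale_mult_left scale_mult_right)

lemma eval_band_edge:
  assumes "i \<le> d" "j \<le> d" "\<bar>int i - int j\<bar> = int (degree p)"
  shows "E i * alg_eval sA p Y * E j = sA (lead_coeff p) (E i * Y ^ degree p * E j)"
proof -
  have "E i * alg_eval sA p Y * E j
      = (\<Sum>n\<le>degree p. sA (coeff p n) (E i * Y ^ n * E j))"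
    by (simp add: alg_eval_def sum_distrib_left sum_distrib_right scale_mult_left
        scale_mult_right)
  also have "\<dots> = (\<Sum>n\<in>{degree p}. sA (coeff p n) (E i * Y ^ n * E j))"
    using assms power_band[of i j] by (intro sum.mono_neutral_right) auto
  finally show ?thesis by simp
qed

lemma adjacent_nonzero:
  assumes "i \<le> d" "j \<le> d" "\<bar>int i - int j\<bar> = 1" "act (E j) v \<noteq> 0"
  shows "act (E i * Y * E j) v \<noteq> 0"
proof
  assume 0: "act (E i * Y * E j) v = 0"
  obtain u where u: "act (E i * Y * E j) u \<noteq> 0" using adjacent[of i j] assms by blast
  obtain c where "act (E j) u = sV c (act (E j) v)" using line[of j v u] assms by blast
  then have "act (E i * Y * E j) u = sV c (act (E i * Y * E j) v)"
    by (simp add: act_mult act_scale_right)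
  with 0 u show False by simp
qed

text \<open>Along the extreme diagonal there is a single path of length \<open>n\<close> from \<open>k\<close> to \<open>k + n\<close>, so no
cancellation can occur between the nonzero steps.\<close>

lemma power_nonzero:
  "k + n \<le> d \<Longrightarrow> act (E k) v \<noteq> 0 \<Longrightarrow> act (E (k + n) * Y ^ n * E k) v \<noteq> 0"
proof (induction n)
  case 0
  then show ?case by (simp add: idempotent)
next
  case (Suc n)
  let ?i = "k + Suc n"
  have "E ?i * Y ^ Suc n * E k = (\<Sum>j\<in>{k + n}. (E ?i * Y * E j) * (E j * Y ^ n * E k))"
    unfolding power_Suc_decompose
  proof (intro sum.mono_neutral_right ballI)
    fix j assume "j \<in> {..d} - {k + n}"
    then have "\<bar>int ?i - int j\<bar> > 1 \<or> \<bar>int j - int k\<bar> > int n" "j \<le> d" by auto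
    then show "(E ?i * Y * E j) * (E j * Y ^ n * E k) = 0"
      using far[of ?i j] power_band[of j k n] Suc.prems by auto
  qed (use Suc.prems in auto)
  then have "E ?i * Y ^ Suc n * E k = E ?i * Y * E (k + n) * (Y ^ n * E k)"
    using Suc.prems by (simp add: mult.assoc) (simp flip: mult.assoc add: idempotent)
  moreover have "act (E (k + n)) (act (Y ^ n * E k) v) \<noteq> 0"
    using Suc by (simp add: mult.assoc flip: act_mult)
  ultimately show ?case
    using adjacent_nonzero[of ?i "k + n" "act (Y ^ n * E k) v"] Suc.prems
    by (simp only: act_mult) simp
qed

lemma reversed_tridiagonal:
  "tridiagonal_frame sA sV act d A (\<lambda>i. E (d - i)) (\<lambda>i. \<theta> (d - i)) tr Y"
proof -
  interpret R: eigenframe sA sV act d A "\<lambda>i. E (d - i)" "\<lambda>i. \<theta> (d - i)" tr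
    by (rule reversed)
  show ?thesis by unfold_locales (auto intro!: far adjacent)
qed

end

text \<open>A Leonard system in a form that is visibly symmetric under exchanging \<open>A\<close> with \<open>A*\<close> and under
reversing either list of idempotents. The three lemmas that follow record these symmetries; each
later fact is proved once and reused through them.\<close>

locale leonard_frames =
  P: tridiagonal_frame sA sV act d A E \<theta> tr As +
  Q: tridiagonal_frame sA sV act d As Es \<theta>s tr A
  for sA :: "'k::field \<Rightarrow> 'a::ring_1 \<Rightarrow> 'a"
    and sV :: "'k \<Rightarrow> 'v::ab_group_add \<Rightarrow> 'v"
    and act :: "'a \<Rightarrow> 'v \<Rightarrow> 'v"
    and d A E \<theta> As Es \<theta>s tr
begin

lemma swapped: "leonard_frames sA sV act d As Es \<theta>s A E \<theta> tr"
  by unfold_locales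

lemma reversed_left:
  "leonard_frames sA sV act d A (\<lambda>i. E (d - i)) (\<lambda>i. \<theta> (d - i)) As Es \<theta>s tr"
  by (intro leonard_frames.intro P.reversed_tridiagonal Q.tridiagonal_frame_axioms)

lemma reversed_right:
  "leonard_frames sA sV act d A E \<theta> As (\<lambda>i. Es (d - i)) (\<lambda>i. \<theta>s (d - i)) tr"
  by (intro leonard_frames.intro Q.reversed_tridiagonal P.tridiagonal_frame_axioms)

text \<open>Suppose that \<open>z\<close> has no component in \<open>E*\<^sub>0V\<close>. Then the monic polynomial \<open>p\<close> of degree \<open>m\<close> with
roots \<open>\<theta>*\<^sub>1, \<dots>, \<theta>*\<^sub>m\<close> satisfies \<open>p(A*) z = 0\<close>. But if \<open>k\<close> is the largest index with \<open>E\<^sub>k z \<noteq> 0\<close>, then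
\<open>E\<^bsub>k+m\<^esub> p(A*) z = E\<^bsub>k+m\<^esub> A*\<^sup>m E\<^sub>k z\<close> is nonzero.\<close>

lemma split_component_nonzero:
  assumes "z \<noteq> 0" "m \<le> d"
    and up: "\<And>j. j \<le> d \<Longrightarrow> m < j \<Longrightarrow> act (Es j) z = 0"
    and down: "\<And>j. j \<le> d \<Longrightarrow> d < m + j \<Longrightarrow> act (E j) z = 0"
  shows "act (Es 0) z \<noteq> 0"
proof
  assume bottom: "act (Es 0) z = 0"
  define p where "p = (\<Prod>j\<in>{1..m}. [:- \<theta>s j, 1:])"
  have deg: "degree p = m" unfolding p_def by (subst degree_prod_eq_sum_degree) simp_all
  have lead: "lead_coeff p = 1" by (simp add: p_def lead_coeff_prod)
  have "act (alg_eval sA p As) z = (\<Sum>j\<le>d. sV (poly p (\<theta>s j)) (act (Es j) z))"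
    by (simp add: Q.eval_eq_sum P.act_sum_left P.act_scale)
  also have "\<dots> = 0"
  proof (intro sum.neutral ballI)
    fix j assume "j \<in> {..d}"
    then show "sV (poly p (\<theta>s j)) (act (Es j) z) = 0"
      using up[of j] bottom by (cases "j = 0"; cases "m < j") (auto simp: p_def poly_prod)
  qed
  finally have kill: "act (alg_eval sA p As) z = 0" .
  define k where "k = Max {j. j \<le> d \<and> act (E j) z \<noteq> 0}"
  have fin: "finite {j. j \<le> d \<and> act (E j) z \<noteq> 0}" by simp
  have "{j. j \<le> d \<and> act (E j) z \<noteq> 0} \<noteq> {}"
    using P.ex_component_nonzero[OF \<open>z \<noteq> 0\<close>] by blast
  from Max_in[OF fin this] have k: "k \<le> d" "act (E k) z \<noteq> 0" by (auto simp: k_def)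
  have above: "act (E j) z = 0" if "j \<le> d" "k < j" for j
    using Max_ge[OF fin, of j] that by (fastforce simp: k_def)
  \<comment> \<open>The index \<open>k + m\<close> is in range because \<open>z\<close> has no component beyond \<open>E\<^bsub>d-m\<^esub>V\<close>.\<close>
  have km: "k + m \<le> d" using down[of k] k by force
  let ?T = "\<lambda>j. E (k + m) * alg_eval sA p As * E j"
  have "0 = act (E (k + m) * alg_eval sA p As) z" by (simp add: P.act_mult kill)
  also have "\<dots> = (\<Sum>j\<le>d. act (?T j) z)"
    by (subst P.sum_components[of z]) (simp add: P.act_sum_right P.act_mult)
  also have "\<dots> = (\<Sum>j\<in>{k}. act (?T j) z)"
  proof (intro sum.mono_neutral_right ballI)
    fix j assume j: "j \<in> {..d} - {k}"
    show "act (?T j) z = 0"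
    proof (cases "k < j")
      case True
      then show ?thesis using above[of j] j by (simp add: P.act_mult)
    next
      case False
      then show ?thesis using P.eval_band[of "k + m" j p] j km deg by simp
    qed
  qed (use k in auto)
  also have "\<dots> = act (E (k + m) * As ^ m * E k) z"
    using P.eval_band_edge[of "k + m" k p] km deg lead by simp
  also have "\<dots> \<noteq> 0" by (intro P.power_nonzero km k)
  finally show False by simp
qed

end

section \<open>Split vectors and split sequences\<close>

lemma prod_telescope_quotient:
  fixes c t :: "nat \<Rightarrow> 'k::field"
  assumes "m \<le> n" "\<And>j. m \<le> j \<Longrightarrow> j \<le> n \<Longrightarrow> t j \<noteq> 0"
  shows "(\<Prod>j=m+1..n. c j * (t j / t (j - 1))) = (\<Prod>j=m+1..n. c j) * t n / t m"
  using assms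
proof (induction n rule: dec_induct)
  case (step n)
  then show ?case by (simp add: prod.nat_ivl_Suc')
qed simp

lemma eta_reversed_eq_tau:
  assumes "i \<le> d"
  shows "eta d (\<lambda>i. \<theta> (d - i)) i = tau \<theta> i"
  unfolding eta_def tau_def using assms by (intro prod.cong) auto

context leonard_frames
begin

text \<open>This lemma and the next place \<open>\<eta>\<^sub>i(A) x\<close>, for \<open>x\<close> in \<open>E*\<^sub>0V\<close>, in the intersection
\<open>(E*\<^sub>0V + \<dots> + E*\<^sub>iV) \<inter> (E\<^sub>0V + \<dots> + E\<^bsub>d-i\<^esub>V)\<close>: one inclusion is the degree bound, the other
comes from the roots of \<open>\<eta>\<^sub>i\<close>.\<close>

lemma eta_vector_above:
  assumes "i \<le> d" "act (Es 0) x = x" "j \<le> d" "i < j"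
  shows "act (Es j) (act (alg_eval sA (eta d \<theta> i) A) x) = 0"
proof -
  have "act (Es j * alg_eval sA (eta d \<theta> i) A * Es 0) x = 0"
    using assms Q.eval_band[of j 0 "eta d \<theta> i"] by simp
  then show ?thesis using assms(2) by (simp add: P.act_mult)
qed

lemma eta_vector_below:
  assumes "i \<le> d" "j \<le> d" "d < i + j"
  shows "act (E j) (act (alg_eval sA (eta d \<theta> i) A) x) = 0"
  using assms by (simp add: P.idempotent_eval P.act_scale poly_eta_root flip: P.act_mult)

lemma eta_vector_nonzero:
  assumes "i \<le> d" "act (Es 0) x = x" "x \<noteq> 0"
  shows "act (alg_eval sA (eta d \<theta> i) A) x \<noteq> 0"
proof
  assume 0: "act (alg_eval sA (eta d \<theta> i) A) x = 0"
  have "Es i * alg_eval sA (eta d \<theta> i) A * Es 0 = Es i * A ^ i * Es 0"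
    using assms Q.eval_band_edge[of i 0 "eta d \<theta> i"] by simp
  then have "act (Es i * A ^ i * Es 0) x = act (Es i * alg_eval sA (eta d \<theta> i) A * Es 0) x"
    by simp
  also have "\<dots> = 0" using assms(2) 0 by (simp add: P.act_mult)
  finally show False using Q.power_nonzero[of 0 i x] assms by simp
qed

lemma compression_vector:
  "act (Es 0) x = x \<Longrightarrow> act (Es 0) (act y x) = sV (tr (y * Es 0)) x"
  by (metis P.act_mult P.act_scale Q.compression le0)

text \<open>The trace is the component in \<open>E*\<^sub>0V\<close> of the nonzero vector \<open>\<eta>\<^sub>i(A) x\<close>.\<close>

lemma trace_eta_nonzero:
  assumes "i \<le> d" "act (Es 0) x = x" "x \<noteq> 0"
  shows "tr (alg_eval sA (eta d \<theta> i) A * Es 0) \<noteq> 0"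
proof
  assume 0: "tr (alg_eval sA (eta d \<theta> i) A * Es 0) = 0"
  have "act (Es 0) (act (alg_eval sA (eta d \<theta> i) A) x) \<noteq> 0"
    by (intro split_component_nonzero[of _ i] eta_vector_nonzero eta_vector_above
        eta_vector_below assms)
  then show False using 0 assms by (simp add: compression_vector)
qed

lemma trace_tau_nonzero:
  assumes "i \<le> d" "act (Es 0) x = x" "x \<noteq> 0"
  shows "tr (alg_eval sA (tau \<theta> i) A * Es 0) \<noteq> 0"
  using leonard_frames.trace_eta_nonzero[OF reversed_left assms] assms(1)
  by (simp add: eta_reversed_eq_tau)

text \<open>A vector of \<open>E\<^sub>0V\<close> lies in the intersection of \<open>split_component_nonzero\<close> for \<open>m = d\<close>, with either
order of the \<open>E*\<^sub>i\<close>.\<close>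

lemma extreme_components_nonzero:
  assumes "act (E 0) u = u" "u \<noteq> 0"
  shows "act (Es 0) u \<noteq> 0" "act (Es d) u \<noteq> 0"
proof -
  have down: "act (E j) u = 0" if "j \<le> d" "d < d + j" for j
  proof -
    have "act (E j) u = act (E j * E 0) u" using assms by (simp add: P.act_mult)
    then show ?thesis using that by (simp add: P.orthogonal)
  qed
  show "act (Es 0) u \<noteq> 0"
    by (rule split_component_nonzero[of _ d]) (use assms down in auto)
  interpret R: leonard_frames sA sV act d A E \<theta> As "\<lambda>i. Es (d - i)" "\<lambda>i. \<theta>s (d - i)" tr
    by (rule reversed_right)
  show "act (Es d) u \<noteq> 0"
    using R.split_component_nonzero[of u d] assms down by auto
qed

text \<open>Both vectors lie in the same intersection and, after scaling, have the same component in \<open>E*\<^sub>0V\<close>,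
namely \<open>\<eta>*\<^sub>r(\<theta>*\<^sub>0) a tr(\<eta>\<^bsub>d-r\<^esub>(A) E*\<^sub>0) x\<close>; hence their difference is zero.\<close>

lemma eta_vectors_parallel:
  assumes "r \<le> d" and u: "act (E 0) u = u" and x: "act (Es 0) x = x"
    and a: "act (Es 0) u = sV a x"
  shows "sV (poly (eta d \<theta>s r) (\<theta>s 0) * a) (act (alg_eval sA (eta d \<theta> (d - r)) A) x)
    = sV (tr (alg_eval sA (eta d \<theta> (d - r)) A * Es 0)) (act (alg_eval sA (eta d \<theta>s r) As) u)"
    (is "sV ?p ?y = sV ?t ?v")
proof (rule ccontr)
  assume "sV ?p ?y \<noteq> sV ?t ?v"
  then have nz: "sV ?p ?y - sV ?t ?v \<noteq> 0" by simp
  interpret S: leonard_frames sA sV act d As Es \<theta>s A E \<theta> tr by (rule swapped)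
  have v: "act (E j) ?v = 0" if "j \<le> d" "r < j" for j
    using S.eta_vector_above[of r u j] assms that by simp
  have v': "act (Es j) ?v = 0" if "j \<le> d" "d < r + j" for j
    using S.eta_vector_below[of r j u] assms that by simp
  have y: "act (Es j) ?y = 0" if "j \<le> d" "d - r < j" for j
    using eta_vector_above[of "d - r" x j] x that by simp
  have y': "act (E j) ?y = 0" if "j \<le> d" "d < d - r + j" for j
    using eta_vector_below[of "d - r" j x] that by simp
  have "act (Es 0) ?v = sV ?p x"
    by (simp add: Q.idempotent_eval P.act_scale a flip: P.act_mult)
  then have "act (Es 0) (sV ?p ?y - sV ?t ?v) = 0"
    by (simp add: P.act_diff_right P.act_scale_right compression_vector[OF x] mult.commute)
  moreover have "act (Es 0) (sV ?p ?y - sV ?t ?v) \<noteq> 0"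
    by (rule split_component_nonzero[OF nz, of "d - r"])
       (use \<open>r \<le> d\<close> in \<open>simp_all add: P.act_diff_right P.act_scale_right v v' y y'\<close>)
  ultimately show False by contradiction
qed

text \<open>For \<open>i < r\<close> the operator \<open>\<tau>\<^sub>r(A)\<close> kills \<open>E\<^sub>0V + \<dots> + E\<^sub>iV\<close>, and for \<open>i > r\<close> it cannot raise a vector of
\<open>E*\<^sub>0V + \<dots> + E*\<^bsub>d-i\<^esub>V\<close> as far as \<open>E*\<^sub>dV\<close>. For \<open>r = i\<close> write \<open>m = d - r\<close> and replace \<open>\<eta>*\<^sub>r(A*) u\<close> by the
parallel vector \<open>\<eta>\<^sub>m(A) x\<close>. The polynomials \<open>\<tau>\<^sub>r \<eta>\<^sub>m\<close> and \<open>\<eta>\<^sub>d\<close> are both monic of degree \<open>d\<close>, so they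
have the same effect between \<open>E*\<^sub>0\<close> and \<open>E*\<^sub>d\<close>, and \<open>\<eta>\<^sub>d(A) x\<close> is in turn parallel to \<open>u\<close>.\<close>

lemma top_component_tau_eta:
  assumes phi: "\<forall>i\<in>{1..d}. phi i = (\<theta>s 0 - \<theta>s i) *
        (tr (alg_eval sA (eta d \<theta> i) A * Es 0) / tr (alg_eval sA (eta d \<theta> (i - 1)) A * Es 0))"
    and x: "act (Es 0) x = x" "x \<noteq> 0" and u: "act (E 0) u = u"
    and "r \<le> d" "i \<le> d"
  shows "act (Es d) (act (alg_eval sA (tau \<theta> r) A) (act (alg_eval sA (eta d \<theta>s i) As) u))
    = (if r = i then sV (\<Prod>j=d-r+1..d. phi j) (act (Es d) u) else 0)"
proof -
  interpret S: leonard_frames sA sV act d As Es \<theta>s A E \<theta> tr by (rule swapped)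
  let ?v = "act (alg_eval sA (eta d \<theta>s i) As) u"
  let ?L = "act (Es d) (act (alg_eval sA (tau \<theta> r) A) ?v)"
  consider "i < r" | "r < i" | "r = i" by linarith
  then show ?thesis
  proof cases
    case 1
    have "act (alg_eval sA (tau \<theta> r) A) ?v
        = (\<Sum>j\<le>d. sV (poly (tau \<theta> r) (\<theta> j)) (act (E j) ?v))"
      by (simp add: P.eval_eq_sum[of "tau \<theta> r"] P.act_sum_left P.act_scale)
    also have "\<dots> = 0"
    proof (intro sum.neutral ballI)
      fix j assume "j \<in> {..d}"
      then show "sV (poly (tau \<theta> r) (\<theta> j)) (act (E j) ?v) = 0"
        using 1 u \<open>i \<le> d\<close> S.eta_vector_above[of i u j] poly_tau_root[of j r \<theta>]
        by (cases "i < j") auto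
    qed
    finally show ?thesis using 1 by simp
  next
    case 2
    have "?L = (\<Sum>j\<le>d. act (Es d * alg_eval sA (tau \<theta> r) A * Es j) ?v)"
      by (subst Q.sum_components[of ?v]) (simp add: P.act_sum_right P.act_mult)
    also have "\<dots> = 0"
    proof (intro sum.neutral ballI)
      fix j assume j: "j \<in> {..d}"
      show "act (Es d * alg_eval sA (tau \<theta> r) A * Es j) ?v = 0"
      proof (cases "d < i + j")
        case True
        then show ?thesis
          using S.eta_vector_below[of i j u] j \<open>i \<le> d\<close> by (simp add: P.act_mult)
      next
        case False
        then show ?thesis using Q.eval_band[of d j "tau \<theta> r"] j 2 by simp
      qed
    qed
    finally show ?thesis using 2 by simp
  next
    case 3
    define t where "t i = tr (alg_eval sA (eta d \<theta> i) A * Es 0)" for i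
    define m where "m = d - r"
    have m: "m \<le> d" "d - r = m" "d - m = r" using \<open>r \<le> d\<close> by (auto simp: m_def)
    have t: "t j \<noteq> 0" if "j \<le> d" for j
      using trace_eta_nonzero[of j x] that x by (simp add: t_def)
    define p where "p = poly (eta d \<theta>s r) (\<theta>s 0)"
    have "(\<Prod>j=m+1..d. phi j) = (\<Prod>j=m+1..d. (\<theta>s 0 - \<theta>s j) * (t j / t (j - 1)))"
      by (intro prod.cong) (auto simp: phi t_def)
    also have "\<dots> = p * t d / t m"
      using prod_telescope_quotient[of m d t "\<lambda>j. \<theta>s 0 - \<theta>s j"] t m
      by (simp add: p_def poly_eta_reindex[OF \<open>r \<le> d\<close>])
    finally have prod: "(\<Prod>j=m+1..d. phi j) = p * t d / t m" .
    obtain a where a: "act (Es 0) u = sV a x" using Q.line[of 0 x u] x by auto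
    let ?y = "\<lambda>i. act (alg_eval sA (eta d \<theta> i) A) x"
    have mid: "sV (p * a) (?y m) = sV (t m) ?v"
      using eta_vectors_parallel[OF \<open>r \<le> d\<close> u x(1) a] 3 m by (simp add: p_def t_def)
    \<comment> \<open>The case \<open>r = 0\<close> of the parallelism, where \<open>\<eta>*\<^sub>0 = 1\<close>.\<close>
    have full: "sV a (?y d) = sV (t d) u"
      using eta_vectors_parallel[of 0 u x a] u x(1) a
      by (simp add: t_def eta_def P.act_one)
    let ?q = "tau \<theta> r * eta d \<theta> m"
    have q: "degree ?q = d" "lead_coeff ?q = 1"
      unfolding lead_coeff_mult using m by (simp_all add: degree_mult_eq)
    have "Es d * alg_eval sA ?q A * Es 0 = Es d * alg_eval sA (eta d \<theta> d) A * Es 0"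
      using Q.eval_band_edge[of d 0 ?q] Q.eval_band_edge[of d 0 "eta d \<theta> d"] q by simp
    from arg_cong[OF this, of "\<lambda>z. act z x"]
    have same: "act (Es d) (act (alg_eval sA (tau \<theta> r) A) (?y m)) = act (Es d) (?y d)"
      using x by (simp add: P.act_mult P.alg_eval_mult)
    have "sV (t m) ?L = act (Es d) (act (alg_eval sA (tau \<theta> r) A) (sV (t m) ?v))"
      by (simp add: P.act_scale_right)
    also have "\<dots> = sV (p * a) (act (Es d) (?y d))"
      by (simp add: P.act_scale_right same flip: mid)
    also have "\<dots> = sV p (act (Es d) (sV a (?y d)))"
      by (simp add: P.act_scale_right)
    also have "\<dots> = sV (p * t d) (act (Es d) u)"
      by (simp add: P.act_scale_right full)
    finally have "sV (1 / t m) (sV (t m) ?L) = sV (1 / t m) (sV (p * t d) (act (Es d) u))"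
      by simp
    then show ?thesis using 3 t[OF m(1)] m prod by simp
  qed
qed

lemma phi_prod_nonzero:
  assumes phi: "\<forall>i\<in>{1..d}. phi i = (\<theta>s 0 - \<theta>s i) *
        (tr (alg_eval sA (eta d \<theta> i) A * Es 0) / tr (alg_eval sA (eta d \<theta> (i - 1)) A * Es 0))"
    and x: "act (Es 0) x = x" "x \<noteq> 0"
  shows "(\<Prod>j=m+1..d. phi j) \<noteq> 0"
proof -
  have "phi j \<noteq> 0" if "j \<in> {m+1..d}" for j
  proof -
    have j: "1 \<le> j" "j \<le> d" "j - 1 \<le> d" using that by auto
    then have "\<theta>s 0 \<noteq> \<theta>s j" using inj_onD[OF Q.inj_eigenvalues, of 0 j] by auto
    with j x show ?thesis using trace_eta_nonzero[of j x] trace_eta_nonzero[of "j - 1" x]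
      by (simp add: phi)
  qed
  then show ?thesis by simp
qed

lemma vphi_prod_nonzero:
  assumes vphi: "\<forall>i\<in>{1..d}. vphi i = (\<theta>s 0 - \<theta>s i) *
        (tr (alg_eval sA (tau \<theta> i) A * Es 0) / tr (alg_eval sA (tau \<theta> (i - 1)) A * Es 0))"
    and x: "act (Es 0) x = x" "x \<noteq> 0"
  shows "(\<Prod>j=1..d. vphi j) \<noteq> 0"
proof -
  have "vphi j \<noteq> 0" if "j \<in> {1..d}" for j
  proof -
    have j: "1 \<le> j" "j \<le> d" "j - 1 \<le> d" using that by auto
    then have "\<theta>s 0 \<noteq> \<theta>s j" using inj_onD[OF Q.inj_eigenvalues, of 0 j] by auto
    with j x show ?thesis using trace_tau_nonzero[of j x] trace_tau_nonzero[of "j - 1" x]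
      by (simp add: vphi)
  qed
  then show ?thesis by simp
qed

text \<open>The product \<open>\<tau>*\<^bsub>d-r\<^esub> \<eta>*\<^sub>i\<close> has degree \<open>d - r + i\<close>. Below \<open>d\<close> this is too small to lead from \<open>E\<^sub>0V\<close> to
\<open>E\<^sub>dV\<close>; at \<open>d\<close> only the leading coefficient matters, so the product may be replaced by \<open>\<eta>*\<^sub>d\<close>;
above \<open>d\<close> the roots of the two factors exhaust the eigenvalues.\<close>

lemma top_component_dual:
  assumes u: "act (E 0) u = u" and "r \<le> d" "i \<le> d"
  shows "act (E d) (act (alg_eval sA (tau \<theta>s (d - r)) As) (act (alg_eval sA (eta d \<theta>s i) As) u))
    = (if r = i then act (E d) (act (alg_eval sA (eta d \<theta>s d) As) u) else 0)"
proof -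
  let ?q = "tau \<theta>s (d - r) * eta d \<theta>s i"
  have q: "degree ?q = d - r + i" "lead_coeff ?q = 1"
    unfolding lead_coeff_mult by (simp_all add: degree_mult_eq)
  have L: "act (E d) (act (alg_eval sA (tau \<theta>s (d - r)) As) (act (alg_eval sA (eta d \<theta>s i) As) u))
      = act (E d * alg_eval sA ?q As * E 0) u"
    using u by (simp add: P.act_mult P.alg_eval_mult)
  consider "i < r" | "r < i" | "r = i" by linarith
  then show ?thesis
  proof cases
    case 1
    then have "E d * alg_eval sA ?q As * E 0 = 0"
      using q \<open>r \<le> d\<close> by (intro P.eval_band) auto
    then show ?thesis unfolding L using 1 by simp
  next
    case 2
    have "alg_eval sA ?q As = 0"
    proof (rule Q.eval_eq_0)
      fix j assume "j \<le> d"
      then show "poly ?q (\<theta>s j) = 0"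
        using 2 poly_tau_root[of j "d - r" \<theta>s] poly_eta_root[of j d i \<theta>s]
        by (cases "j < d - r") auto
    qed
    then show ?thesis unfolding L using 2 by simp
  next
    case 3
    then have "E d * alg_eval sA ?q As * E 0 = E d * alg_eval sA (eta d \<theta>s d) As * E 0"
      using P.eval_band_edge[of d 0 ?q] P.eval_band_edge[of d 0 "eta d \<theta>s d"] q \<open>r \<le> d\<close> by simp
    then show ?thesis unfolding L using 3 u by (simp add: P.act_mult)
  qed
qed

text \<open>Here \<open>\<eta>*\<^sub>d(A*)\<close> and \<open>\<tau>\<^sub>d(A)\<close> are multiples of \<open>E*\<^sub>0\<close> and \<open>E\<^sub>d\<close>, so the left side is a multiple of
\<open>E*\<^sub>0 \<tau>\<^sub>d(A) E*\<^sub>0 u = tr(\<tau>\<^sub>d(A) E*\<^sub>0) E*\<^sub>0 u\<close>, and the product of the split sequence telescopes to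
\<open>\<eta>*\<^sub>d(\<theta>*\<^sub>0) tr(\<tau>\<^sub>d(A) E*\<^sub>0)\<close>.\<close>

lemma first_split_product:
  assumes vphi: "\<forall>i\<in>{1..d}. vphi i = (\<theta>s 0 - \<theta>s i) *
        (tr (alg_eval sA (tau \<theta> i) A * Es 0) / tr (alg_eval sA (tau \<theta> (i - 1)) A * Es 0))"
    and x: "act (Es 0) x = x" "x \<noteq> 0"
  shows "sV (poly (tau \<theta> d) (\<theta> d))
      (act (Es 0) (act (E d) (act (alg_eval sA (eta d \<theta>s d) As) u)))
    = sV (\<Prod>j=1..d. vphi j) (act (Es 0) u)"
proof -
  define t where "t i = tr (alg_eval sA (tau \<theta> i) A * Es 0)" for i
  define p where "p = poly (eta d \<theta>s d) (\<theta>s 0)"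
  have t: "t j \<noteq> 0" if "j \<le> d" for j
    using trace_tau_nonzero[of j x] that x by (simp add: t_def)
  have "sV (t 0) x = sV 1 x"
    using compression_vector[of x 1] x by (simp add: t_def tau_def P.act_one)
  then have t0: "t 0 = 1" using x(2) by (metis P.V.scale_cancel_right)
  have "(\<Prod>j=1..d. vphi j) = (\<Prod>j=0+1..d. (\<theta>s 0 - \<theta>s j) * (t j / t (j - 1)))"
    by (intro prod.cong) (auto simp: vphi t_def)
  also have "\<dots> = (\<Prod>j=0+1..d. \<theta>s 0 - \<theta>s j) * t d / t 0"
    by (rule prod_telescope_quotient) (use t in auto)
  also have "\<dots> = p * t d"
    by (simp add: t0 p_def poly_eta_reindex)
  finally have prod: "(\<Prod>j=1..d. vphi j) = p * t d" .
  have eta: "alg_eval sA (eta d \<theta>s d) As = sA p (Es 0)"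
    unfolding p_def by (rule Q.eval_eq_single) (auto simp: poly_eta_root)
  have tau: "alg_eval sA (tau \<theta> d) A = sA (poly (tau \<theta> d) (\<theta> d)) (E d)"
    by (rule P.eval_eq_single) (auto simp: poly_tau_root)
  have "sV (poly (tau \<theta> d) (\<theta> d)) (act (Es 0) (act (E d) (act (alg_eval sA (eta d \<theta>s d) As) u)))
      = sV p (act (Es 0 * alg_eval sA (tau \<theta> d) A * Es 0) u)"
    by (simp add: eta tau P.act_mult P.act_scale P.act_scale_right mult.commute)
  also have "\<dots> = sV (p * t d) (act (Es 0) u)"
    by (subst Q.compression) (simp_all add: t_def P.act_scale)
  finally show ?thesis using prod by simp
qed

text \<open>The compression rule gives \<open>E*\<^sub>d E\<^sub>0 E*\<^sub>d = tr(E\<^sub>0 E*\<^sub>d) E*\<^sub>d\<close>; applying \<open>E*\<^sub>d\<close> to \<open>E\<^sub>0 E*\<^sub>d u = c u\<close>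
therefore identifies \<open>c\<close>.\<close>

lemma corner_trace:
  assumes u: "act (E 0) u = u" "u \<noteq> 0"
  shows "act (E 0) (act (Es d) u) = sV (tr (E 0 * Es d)) u" "tr (E 0 * Es d) \<noteq> 0"
proof -
  obtain c where c: "act (E 0) (act (Es d) u) = sV c u"
    using P.line[of 0 u] u by auto
  have nz: "act (Es d) u \<noteq> 0" using extreme_components_nonzero u by simp
  have "sV c (act (Es d) u) = act (Es d * E 0 * Es d) u"
    by (simp add: P.act_mult c P.act_scale_right)
  also have "\<dots> = sV (tr (E 0 * Es d)) (act (Es d) u)"
    by (subst Q.compression) (simp_all add: P.act_scale)
  finally have eq: "c = tr (E 0 * Es d)" using nz by simp
  then show "act (E 0) (act (Es d) u) = sV (tr (E 0 * Es d)) u" using c by simp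
  interpret S: leonard_frames sA sV act d As "\<lambda>i. Es (d - i)" "\<lambda>i. \<theta>s (d - i)" A E \<theta> tr
    by (rule leonard_frames.swapped[OF reversed_right])
  have "act (Es d) (act (Es d) u) = act (Es d) u"
    by (simp add: Q.idempotent flip: P.act_mult)
  then have "act (E 0) (act (Es d) u) \<noteq> 0"
    using S.extreme_components_nonzero(1)[of "act (Es d) u"] nz by simp
  then show "tr (E 0 * Es d) \<noteq> 0" using c eq by auto
qed

end

section \<open>Self-adjoint elements\<close>

locale nondegenerate_form =
  algebra_module sA sV act
  for sA :: "'k::field \<Rightarrow> 'a::ring_1 \<Rightarrow> 'a"
    and sV :: "'k \<Rightarrow> 'v::ab_group_add \<Rightarrow> 'v"
    and act :: "'a \<Rightarrow> 'v \<Rightarrow> 'v" +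
  fixes B :: "'v \<Rightarrow> 'v \<Rightarrow> 'k"
  assumes bilinear: "bilinear_form sV B"
    and nondegenerate: "(\<And>v. B u v = 0) \<Longrightarrow> u = 0"
begin

lemma form_add: "B (u + v) z = B u z + B v z" "B z (u + v) = B z u + B z v"
  and form_scale: "B (sV c u) z = c * B u z" "B z (sV c u) = c * B z u"
  using bilinear by (auto simp: bilinear_form_def Vector_Spaces.linear_iff)

lemma form_zero [simp]: "B 0 z = 0" "B z 0 = 0"
  using form_scale(1)[where c = 0 and u = 0] form_scale(2)[where c = 0 and u = 0] by simp_all

lemma form_sum: "B (\<Sum>i\<in>S. f i) z = (\<Sum>i\<in>S. B (f i) z)" "B z (\<Sum>i\<in>S. f i) = (\<Sum>i\<in>S. B z (f i))"
  by (induction S rule: infinite_finite_induct) (simp_all add: form_add)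

end

locale self_adjoint_frame =
  eigenframe sA sV act d A E \<theta> tr + nondegenerate_form sA sV act B
  for sA :: "'k::field \<Rightarrow> 'a::ring_1 \<Rightarrow> 'a"
    and sV :: "'k \<Rightarrow> 'v::ab_group_add \<Rightarrow> 'v"
    and act :: "'a \<Rightarrow> 'v \<Rightarrow> 'v"
    and d A E \<theta> tr B +
  assumes self_adjoint: "B (act A u) v = B u (act A v)"
begin

lemma form_orthogonal:
  assumes "i \<le> d" "j \<le> d" "i \<noteq> j"
  shows "B (act (E i) u) (act (E j) v) = 0"
proof -
  have "\<theta> i * B (act (E i) u) (act (E j) v) = B (act A (act (E i) u)) (act (E j) v)"
    using assms by (simp add: eigen act_scale form_scale flip: act_mult)
  also have "\<dots> = \<theta> j * B (act (E i) u) (act (E j) v)"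
    using assms by (subst self_adjoint) (simp add: eigen act_scale form_scale flip: act_mult)
  finally show ?thesis using assms inj_onD[OF inj_eigenvalues, of i j] by auto
qed

lemma form_component:
  assumes "i \<le> d" "act (E i) v = v"
  shows "B (act (E i) u) v = B u v" "B v (act (E i) u) = B v u"
proof -
  have "B u v = (\<Sum>j\<le>d. B (act (E j) u) (act (E i) v))"
    by (subst sum_components[of u]) (simp add: form_sum assms)
  also have "\<dots> = (\<Sum>j\<in>{i}. B (act (E j) u) (act (E i) v))"
    using assms(1) by (intro sum.mono_neutral_right) (auto simp: form_orthogonal)
  finally show "B (act (E i) u) v = B u v" using assms by simp
  have "B v u = (\<Sum>j\<le>d. B (act (E i) v) (act (E j) u))"
    by (subst sum_components[of u]) (simp add: form_sum assms)
  also have "\<dots> = (\<Sum>j\<in>{i}. B (act (E i) v) (act (E j) u))"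
    using assms(1) by (intro sum.mono_neutral_right) (auto simp: form_orthogonal)
  finally show "B v (act (E i) u) = B v u" using assms by simp
qed

lemma form_anisotropic:
  assumes "i \<le> d" "act (E i) v = v" "v \<noteq> 0"
  shows "B v v \<noteq> 0"
proof
  assume 0: "B v v = 0"
  have "B v u = 0" for u
  proof -
    obtain c where "act (E i) u = sV c v" using line[of i v u] assms by auto
    then show ?thesis using form_component(2)[OF assms(1,2), of u] 0 by (simp add: form_scale)
  qed
  then show False using nondegenerate assms by blast
qed

text \<open>Orthogonality of the eigenspaces of a self-adjoint element makes \<open>E\<^sub>i\<close> the orthogonal projection onto
the line spanned by \<open>v\<close>; nondegeneracy makes \<open>v\<close> anisotropic.\<close>

lemma component_eq_form_quotient:
  assumes "i \<le> d" "act (E i) v = v" "v \<noteq> 0"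
  shows "act (E i) u = sV (B u v / B v v) v"
proof -
  obtain c where c: "act (E i) u = sV c v" using line[of i v u] assms by auto
  then have "B u v = c * B v v" using form_component(1)[OF assms(1,2), of u] by (simp add: form_scale)
  then show ?thesis using c form_anisotropic[OF assms] by simp
qed

end

text \<open>The adjunction makes the left radical a submodule.\<close>

lemma radical_trivial:
  assumes "algebra_module sA sV act" and irr: "irreducible_module act"
    and "bilinear_form sV B" "B u0 v0 \<noteq> 0"
    and adj: "\<And>x u v. B (act x u) v = B u (act (dag x) v)"
    and u: "\<And>v. B u v = 0"
  shows "u = 0"
proof -
  interpret algebra_module sA sV act by fact
  have add: "B (u + v) z = B u z + B v z" for u v z
    using assms(3) by (auto simp: bilinear_form_def Vector_Spaces.linear_iff)
  have "B 0 z = 0" for z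
  proof -
    have "B 0 z + B 0 z = 0 + B 0 z" using add[of 0 0 z] by (simp only: add_0)
    then show ?thesis by (simp only: add_right_cancel)
  qed
  then have "is_submodule act {u. \<forall>v. B u v = 0}"
    by (auto simp: is_submodule_def add adj)
  moreover have "u0 \<notin> {u. \<forall>v. B u v = 0}" using assms(4) by blast
  ultimately have "{u. \<forall>v. B u v = 0} = {0}" using irr unfolding irreducible_module_def by blast
  then show ?thesis using u by blast
qed

section \<open>The relations for a Leonard system\<close>

theorem theorem19p1:
  fixes d :: nat
    and sA :: "'k::field \<Rightarrow> 'a::ring_1 \<Rightarrow> 'a"
    and sV :: "'k \<Rightarrow> 'v::ab_group_add \<Rightarrow> 'v"
    and act :: "'a \<Rightarrow> 'v \<Rightarrow> 'v"
    and \<rho> :: "'a \<Rightarrow> 'k mat"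
    and A As :: 'a
    and E Es :: "nat \<Rightarrow> 'a"
    and \<theta> \<theta>s vphi phi :: "nat \<Rightarrow> 'k"
    and dag :: "'a \<Rightarrow> 'a"
    and B :: "'v \<Rightarrow> 'v \<Rightarrow> 'k"
    and \<xi>0 \<xi>d \<xi>s0 \<xi>sd :: 'v
  assumes "field_algebra sA"
    and "matrix_algebra_iso (d + 1) sA \<rho>"
    and "algebra_module sA sV act"
    and "irreducible_module act"
    and "leonard_system d sA sV act A E As Es"
    and "parameter_array d sA sV act \<rho> A E As Es \<theta> \<theta>s vphi phi"
    and "antiautomorphism sA dag" and "dag A = A" and "dag As = As"
    and "bilinear_form sV B" and "\<exists>u v. B u v \<noteq> 0"
    and "\<And>x u v. B (act x u) v = B u (act (dag x) v)"
    and "\<xi>0 \<in> range (act (E 0))" and "\<xi>0 \<noteq> 0"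
    and "\<xi>d \<in> range (act (E d))" and "\<xi>d \<noteq> 0"
    and "\<xi>s0 \<in> range (act (Es 0))" and "\<xi>s0 \<noteq> 0"
    and "\<xi>sd \<in> range (act (Es d))" and "\<xi>sd \<noteq> 0"
  shows "(\<forall>X \<in> {E, \<lambda>i. E (d - i),
                \<lambda>i. alg_eval sA (tau \<theta> i) A, \<lambda>i. alg_eval sA (tau \<theta> (d - i)) A,
                \<lambda>i. alg_eval sA (eta d \<theta> i) A, \<lambda>i. alg_eval sA (eta d \<theta> (d - i)) A}.
          \<forall>i\<le>d.
            act (sA (poly (tau \<theta> d) (\<theta> d) / (\<Prod>j=1..d. vphi j) * (B \<xi>s0 \<xi>s0 / B \<xi>0 \<xi>s0))
                  (\<Sum>r=0..d. X r * Es 0 * E d * alg_eval sA (tau \<theta>s (d - r)) As))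
              (act (alg_eval sA (eta d \<theta>s i) As) \<xi>0) = act (X i) \<xi>s0 \<and>
            act (sA (B \<xi>sd \<xi>sd / B \<xi>0 \<xi>sd)
                  (\<Sum>r=0..d. sA (1 / (\<Prod>j=d-r+1..d. phi j))
                    (X r * Es d * alg_eval sA (tau \<theta> r) A)))
              (act (alg_eval sA (eta d \<theta>s i) As) \<xi>0) = act (X i) \<xi>sd \<and>
            act (sA (poly (tau \<theta> d) (\<theta> d) / (\<Prod>j=1..d. vphi j) * (B \<xi>s0 \<xi>s0 / B \<xi>0 \<xi>s0))
                  (\<Sum>r=0..d. X (d - r) * Es 0 * E d * alg_eval sA (tau \<theta>s (d - r)) As))
              (act (alg_eval sA (eta d \<theta>s (d - i)) As) \<xi>0) = act (X i) \<xi>s0 \<and>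
            act (sA (B \<xi>sd \<xi>sd / B \<xi>0 \<xi>sd)
                  (\<Sum>r=0..d. sA (1 / (\<Prod>j=d-r+1..d. phi j))
                    (X (d - r) * Es d * alg_eval sA (tau \<theta> r) A)))
              (act (alg_eval sA (eta d \<theta>s (d - i)) As) \<xi>0) = act (X i) \<xi>sd)
       \<and>
         (\<forall>X \<in> {Es, \<lambda>i. Es (d - i),
                \<lambda>i. alg_eval sA (tau \<theta>s i) As, \<lambda>i. alg_eval sA (tau \<theta>s (d - i)) As,
                \<lambda>i. alg_eval sA (eta d \<theta>s i) As, \<lambda>i. alg_eval sA (eta d \<theta>s (d - i)) As}.
          \<forall>i\<le>d.
            act (sA (1 / alg_trace \<rho> (E 0 * Es d))
                  (\<Sum>r=0..d. sA (1 / (\<Prod>j=d-r+1..d. phi j))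
                    (X r * E 0 * Es d * alg_eval sA (tau \<theta> r) A)))
              (act (alg_eval sA (eta d \<theta>s i) As) \<xi>0) = act (X i) \<xi>0 \<and>
            act (sA (poly (tau \<theta> d) (\<theta> d) / (\<Prod>j=1..d. phi j) * (B \<xi>d \<xi>sd / B \<xi>0 \<xi>sd))
                  (\<Sum>r=0..d. X r * E d * alg_eval sA (tau \<theta>s (d - r)) As))
              (act (alg_eval sA (eta d \<theta>s i) As) \<xi>0) = act (X i) \<xi>d \<and>
            act (sA (1 / alg_trace \<rho> (E 0 * Es d))
                  (\<Sum>r=0..d. sA (1 / (\<Prod>j=d-r+1..d. phi j))
                    (X (d - r) * E 0 * Es d * alg_eval sA (tau \<theta> r) A)))
              (act (alg_eval sA (eta d \<theta>s (d - i)) As) \<xi>0) = act (X i) \<xi>0 \<and>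
            act (sA (poly (tau \<theta> d) (\<theta> d) / (\<Prod>j=1..d. phi j) * (B \<xi>d \<xi>sd / B \<xi>0 \<xi>sd))
                  (\<Sum>r=0..d. X (d - r) * E d * alg_eval sA (tau \<theta>s (d - r)) As))
              (act (alg_eval sA (eta d \<theta>s (d - i)) As) \<xi>0) = act (X i) \<xi>d)"
proof -
  interpret algebra_module sA sV act by fact
  obtain w where "module_coordinates sA sV act (d + 1) \<rho> w"
    using ex_module_coordinates assms by blast
  then interpret module_coordinates sA sV act "d + 1" \<rho> w .
  have ordA: "idempotent_ordering d sA sV act A E \<theta>"
    and ordAs: "idempotent_ordering d sA sV act As Es \<theta>s"
    and vphi: "\<forall>i\<in>{1..d}. vphi i = (\<theta>s 0 - \<theta>s i) *
        (alg_trace \<rho> (alg_eval sA (tau \<theta> i) A * Es 0) /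
         alg_trace \<rho> (alg_eval sA (tau \<theta> (i - 1)) A * Es 0))"
    and phi: "\<forall>i\<in>{1..d}. phi i = (\<theta>s 0 - \<theta>s i) *
        (alg_trace \<rho> (alg_eval sA (eta d \<theta> i) A * Es 0) /
         alg_trace \<rho> (alg_eval sA (eta d \<theta> (i - 1)) A * Es 0))"
    using \<open>parameter_array _ _ _ _ _ _ _ _ _ _ _ _ _\<close> unfolding parameter_array_def by auto
  have faithful: "\<exists>v. act x v \<noteq> 0" if "x \<noteq> 0" for x
    using act_faithful[of x 0] that by auto
  interpret B: nondegenerate_form sA sV act B
    by unfold_locales (use assms radical_trivial[of sA sV act B] in blast)+
  have adj: "B (act A u) v = B u (act A v)" "B (act As u) v = B u (act As v)" for u v
    by (simp_all add: assms)
  interpret P: self_adjoint_frame sA sV act d A E \<theta> "alg_trace \<rho>" B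
    by (intro self_adjoint_frame.intro self_adjoint_frame_axioms.intro trace_eigenframe ordA
        B.nondegenerate_form_axioms adj refl)
  interpret Q: self_adjoint_frame sA sV act d As Es \<theta>s "alg_trace \<rho>" B
    by (intro self_adjoint_frame.intro self_adjoint_frame_axioms.intro trace_eigenframe ordAs
        B.nondegenerate_form_axioms adj refl)
  interpret L: leonard_frames sA sV act d A E \<theta> As Es \<theta>s "alg_trace \<rho>"
    using \<open>leonard_system _ _ _ _ _ _ _ _\<close>
    by unfold_locales (auto simp: leonard_system_def intro!: faithful)
  have fixed: "act (E 0) \<xi>0 = \<xi>0" "act (E d) \<xi>d = \<xi>d"
    "act (Es 0) \<xi>s0 = \<xi>s0" "act (Es d) \<xi>sd = \<xi>sd"
    using assms by (auto simp: P.idempotent Q.idempotent simp flip: act_mult)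
  define T where "T = poly (tau \<theta> d) (\<theta> d)"
  define vp where "vp = (\<Prod>j=1..d. vphi j)"
  define ph where "ph = (\<Prod>j=1..d. phi j)"
  define b0 where "b0 = B \<xi>s0 \<xi>s0"
  define bd where "bd = B \<xi>sd \<xi>sd"
  define G where "G = act (E d) (act (alg_eval sA (eta d \<theta>s d) As) \<xi>0)"
  note fd = fixed \<open>\<xi>0 \<noteq> 0\<close> \<open>\<xi>d \<noteq> 0\<close> \<open>\<xi>s0 \<noteq> 0\<close> \<open>\<xi>sd \<noteq> 0\<close>
  have comp0: "act (Es 0) u = sV (B u \<xi>s0 / b0) \<xi>s0" for u
    unfolding b0_def by (intro Q.component_eq_form_quotient) (use fd in auto)
  have compd: "act (Es d) u = sV (B u \<xi>sd / bd) \<xi>sd" for u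
    unfolding bd_def by (intro Q.component_eq_form_quotient) (use fd in auto)
  have b: "b0 \<noteq> 0" "bd \<noteq> 0"
    unfolding b0_def bd_def by (intro Q.form_anisotropic; use fd in auto)+
  have B0: "B \<xi>0 \<xi>s0 \<noteq> 0" "B \<xi>0 \<xi>sd \<noteq> 0"
    using L.extreme_components_nonzero[of \<xi>0] fd comp0[of \<xi>0] compd[of \<xi>0] by auto
  have nz: "vp \<noteq> 0" "ph \<noteq> 0" "(\<Prod>j=m+1..d. phi j) \<noteq> 0" for m
    using L.vphi_prod_nonzero[OF vphi fd(3) fd(7)] L.phi_prod_nonzero[OF phi fd(3) fd(7)]
      L.phi_prod_nonzero[OF phi fd(3) fd(7), of 0]
    by (simp_all add: vp_def ph_def)
  note top = L.top_component_tau_eta[OF phi fd(3) fd(7) fd(1)]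
  have Ttau: "alg_eval sA (tau \<theta> d) A = sA T (E d)"
    unfolding T_def by (rule P.eval_eq_single) (auto simp: poly_tau_root)
  have G0: "sV (T / vp * (b0 / B \<xi>0 \<xi>s0)) (act (Es 0) G) = \<xi>s0"
  proof -
    have "sV T (act (Es 0) G) = sV vp (act (Es 0) \<xi>0)"
      unfolding T_def vp_def G_def by (rule L.first_split_product[OF vphi fd(3) fd(7)])
    also have "\<dots> = sV (vp * (B \<xi>0 \<xi>s0 / b0)) \<xi>s0" by (simp add: comp0)
    finally have "sV (b0 / (vp * B \<xi>0 \<xi>s0)) (sV T (act (Es 0) G))
        = sV (b0 / (vp * B \<xi>0 \<xi>s0)) (sV (vp * (B \<xi>0 \<xi>s0 / b0)) \<xi>s0)" by simp
    then show ?thesis using nz(1) b B0 by (simp add: field_simps)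
  qed
  \<comment> \<open>Apply \<open>E*\<^sub>d\<close> to \<open>G = k \<xi>\<^sub>d\<close>: the case \<open>r = i = d\<close> of \<open>top\<close> computes the result through \<open>\<tau>\<^sub>d(A) = T E\<^sub>d\<close>.\<close>
  have Gd: "sV (T / ph * (B \<xi>d \<xi>sd / B \<xi>0 \<xi>sd)) G = \<xi>d"
  proof -
    obtain k where k: "G = sV k \<xi>d"
      using P.line[of d \<xi>d "act (alg_eval sA (eta d \<theta>s d) As) \<xi>0"] fd by (auto simp: G_def)
    have "sV T (act (Es d) G) = sV ph (act (Es d) \<xi>0)"
      using top[of d d] by (simp add: Ttau act_scale act_scale_right G_def ph_def)
    then have "sV (T * (k * (B \<xi>d \<xi>sd / bd))) \<xi>sd = sV (ph * (B \<xi>0 \<xi>sd / bd)) \<xi>sd"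
      by (simp add: k act_scale_right compd)
    then have "T * (k * (B \<xi>d \<xi>sd / bd)) = ph * (B \<xi>0 \<xi>sd / bd)"
      using fd by (metis V.scale_cancel_right)
    then have "T / ph * (B \<xi>d \<xi>sd / B \<xi>0 \<xi>sd) * k = 1"
      using nz b B0 by (simp add: field_simps)
    then show ?thesis by (simp only: k V.scale_scale V.scale_one)
  qed
  let ?v = "\<lambda>i. act (alg_eval sA (eta d \<theta>s i) As) \<xi>0"
  have one: "act (sA (T / vp * (b0 / B \<xi>0 \<xi>s0))
      (\<Sum>r=0..d. X r * Es 0 * E d * alg_eval sA (tau \<theta>s (d - r)) As)) (?v i) = act (X i) \<xi>s0"
    if "i \<le> d" for X i
    unfolding mult.assoc
    by (rule act_sum_single[OF _ that G0])
       (use that in \<open>simp add: act_mult L.top_component_dual[OF fd(1)] G_def\<close>)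
  have two: "act (sA (bd / B \<xi>0 \<xi>sd)
      (\<Sum>r=0..d. sA (1 / (\<Prod>j=d-r+1..d. phi j)) (X r * Es d * alg_eval sA (tau \<theta> r) A))) (?v i)
      = act (X i) \<xi>sd" if "i \<le> d" for X i
    unfolding mult.assoc scale_mult_right[symmetric]
  proof (rule act_sum_single[OF _ that])
    show "sV (bd / B \<xi>0 \<xi>sd) (act (Es d) \<xi>0) = \<xi>sd" using b B0 by (simp add: compd)
    show "act (Es d * sA (1 / (\<Prod>j=d-r+1..d. phi j)) (alg_eval sA (tau \<theta> r) A)) (?v i)
        = (if r = i then act (Es d) \<xi>0 else 0)" if "r \<le> d" for r
      using top[OF that(1) \<open>i \<le> d\<close>] nz(3)[of "d - r"]
      by (simp add: act_mult act_scale act_scale_right)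
  qed
  have three: "act (sA (1 / alg_trace \<rho> (E 0 * Es d))
      (\<Sum>r=0..d. sA (1 / (\<Prod>j=d-r+1..d. phi j)) (X r * E 0 * Es d * alg_eval sA (tau \<theta> r) A))) (?v i)
      = act (X i) \<xi>0" if "i \<le> d" for X i
    unfolding mult.assoc scale_mult_right[symmetric]
  proof (rule act_sum_single[OF _ that])
    show "sV (1 / alg_trace \<rho> (E 0 * Es d)) (act (E 0) (act (Es d) \<xi>0)) = \<xi>0"
      using L.corner_trace[of \<xi>0] fd by simp
    show "act (E 0 * (Es d * sA (1 / (\<Prod>j=d-r+1..d. phi j)) (alg_eval sA (tau \<theta> r) A))) (?v i)
        = (if r = i then act (E 0) (act (Es d) \<xi>0) else 0)" if "r \<le> d" for r
      using top[OF that(1) \<open>i \<le> d\<close>] nz(3)[of "d - r"]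
      by (simp add: act_mult act_scale act_scale_right)
  qed
  have four: "act (sA (T / ph * (B \<xi>d \<xi>sd / B \<xi>0 \<xi>sd))
      (\<Sum>r=0..d. X r * E d * alg_eval sA (tau \<theta>s (d - r)) As)) (?v i) = act (X i) \<xi>d"
    if "i \<le> d" for X i
    unfolding mult.assoc
    by (rule act_sum_single[OF _ that Gd])
       (use that in \<open>simp add: act_mult L.top_component_dual[OF fd(1)] G_def\<close>)
  note fold = T_def[symmetric] vp_def[symmetric] ph_def[symmetric] b0_def[symmetric] bd_def[symmetric]
  \<comment> \<open>The identities with reversed summation are the others for the sequence \<open>X\<^bsub>d-r\<^esub>\<close> at the index \<open>d - i\<close>.\<close>
  show ?thesis unfolding fold
    apply (rule conjI; rule ballI; rule allI; rule impI)
    subgoal premises p for X i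
      by (rule conjI[OF one[OF p(2)] conjI[OF two[OF p(2)] conjI[OF
          one[of "d - i" "\<lambda>r. X (d - r)", unfolded diff_diff_cancel[OF p(2)],
            OF diff_le_self]
          two[of "d - i" "\<lambda>r. X (d - r)", unfolded diff_diff_cancel[OF p(2)],
            OF diff_le_self]]]])
    subgoal premises p for X i
      by (rule conjI[OF three[OF p(2)] conjI[OF four[OF p(2)] conjI[OF
          three[of "d - i" "\<lambda>r. X (d - r)", unfolded diff_diff_cancel[OF p(2)],
            OF diff_le_self]
          four[of "d - i" "\<lambda>r. X (d - r)", unfolded diff_diff_cancel[OF p(2)],
            OF diff_le_self]]]])
    done
qed

end
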